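(* Let $p$ be a prime, ${\rm F}/{\rm K}$ a finite Galois extension of number fields whose Galois group ${\rm G}$ is a $p$-group, and let $N'_{\rm G}:{\mathcal E}_{\rm F}\to{\mathcal E}_{\rm K}$ be the map induced by the norm of ${\rm F}/{\rm K}$. Write $N'_{\rm G}({\mathcal E}_{\rm F})\simeq{\mathbb F}_p^{t}$. Then $$t_{\rm G}({\mathcal E}_{\rm F})\le t\le t_{\rm G}({\mathcal E}_{\rm F})+d\Big(\frac{{\mathcal O}_{\rm K}^\times\cap({\mathcal O}_{\rm F}^\times)^p}{({\mathcal O}_{\rm K}^\times)^p}\Big).$$ In particular, if ${\mathcal O}_{\rm K}^\times\cap({\mathcal O}_{\rm F}^\times)^p=({\mathcal O}_{\rm K}^\times)^p$, then $t=t_{\rm G}({\mathcal E}_{\rm F})$.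
   Context: ${\mathcal E}_{\rm F}={\mathcal O}_{\rm F}^\times/({\mathcal O}_{\rm F}^\times)^p$ for a number field ${\rm F}$; $d(M)=\dim_{{\mathbb F}_p}({\mathbb F}_p\otimes M)$. For a finitely generated ${\mathbb F}_p[{\rm G}]$-module $M$, $t_{\rm G}(M)$ is the rank of a maximal free ${\mathbb F}_p[{\rm G}]$-submodule ($M\simeq{\mathbb F}_p[{\rm G}]^t\oplus N$ with $N$ having no nonzero free submodule, $t$ uniquely determined). *)

theory Defs
  imports "HOL-Algebra.Algebra" "HOL-Algebra.Algebraic_Closure_Type" "HOL-Number_Theory.Residues"
begin

section \<open>Number fields\<close>

definition number_field :: "('a, 'b) ring_scheme \<Rightarrow> bool" where
  "number_field F \<longleftrightarrow> field F \<and>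
     (\<exists>Q. subfield Q F \<and> F\<lparr>carrier := Q\<rparr> \<simeq> (ring_of_type_algebra :: rat ring) \<and>
          ring.finite_dimension F Q (carrier F))"

text \<open>Polynomials are coefficient lists with the leading coefficient first; their coefficients are
  taken in the image of the integers in the ring.\<close>

definition integral_over_Z :: "('a, 'b) ring_scheme \<Rightarrow> 'a \<Rightarrow> bool" where
  "integral_over_Z F x \<longleftrightarrow>
     (\<exists>q. polynomial\<^bsub>F\<^esub> (range (\<lambda>n::int. add_pow F n \<one>\<^bsub>F\<^esub>)) q \<and> q \<noteq> [] \<and>
          hd q = \<one>\<^bsub>F\<^esub> \<and> ring.eval F q x = \<zero>\<^bsub>F\<^esub>)"

definition ring_of_integers :: "('a, 'b) ring_scheme \<Rightarrow> ('a, 'b) ring_scheme" where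
  "ring_of_integers F = F\<lparr>carrier := {x \<in> carrier F. integral_over_Z F x}\<rparr>"

definition unit_group :: "('a, 'b) ring_scheme \<Rightarrow> 'a monoid" where
  "unit_group F = units_of (ring_of_integers F)"

definition powers :: "nat \<Rightarrow> ('a, 'b) monoid_scheme \<Rightarrow> 'a set" where
  "powers p A = {x [^]\<^bsub>A\<^esub> p | x. x \<in> carrier A}"

definition units_mod_powers :: "nat \<Rightarrow> ('a, 'b) ring_scheme \<Rightarrow> 'a set monoid" where
  "units_mod_powers p F = unit_group F Mod powers p (unit_group F)"


section \<open>Galois extensions and the norm\<close>

text \<open>As in \<^term>\<open>Bij\<close>, automorphisms are extensional functions, so that each is counted once.\<close>

definition galois_group :: "('a, 'b) ring_scheme \<Rightarrow> 'a set \<Rightarrow> ('a \<Rightarrow> 'a) monoid" where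
  "galois_group F K = (BijGroup (carrier F))
     \<lparr>carrier := {\<sigma> \<in> Bij (carrier F). \<sigma> \<in> ring_hom F F \<and> (\<forall>x\<in>K. \<sigma> x = x)}\<rparr>"

definition finite_galois :: "('a, 'b) ring_scheme \<Rightarrow> 'a set \<Rightarrow> bool" where
  "finite_galois F K \<longleftrightarrow> field F \<and> subfield K F \<and> ring.finite_dimension F K (carrier F) \<and>
     {x \<in> carrier F. \<forall>\<sigma> \<in> carrier (galois_group F K). \<sigma> x = x} = K"

definition field_norm :: "('a, 'b) ring_scheme \<Rightarrow> 'a set \<Rightarrow> 'a \<Rightarrow> 'a" where
  "field_norm F K x = (\<Otimes>\<^bsub>F\<^esub>\<sigma>\<in>carrier (galois_group F K). \<sigma> x)"

text \<open>The induced map sends the class of a unit \<open>x\<close> to the class of its norm: for a coset \<open>C\<close>, the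
  product set below is the single coset of \<open>field_norm F K x\<close>, for any \<open>x\<close> in \<open>C\<close>.\<close>

definition induced_norm :: "nat \<Rightarrow> ('a, 'b) ring_scheme \<Rightarrow> 'a set \<Rightarrow> 'a set \<Rightarrow> 'a set" where
  "induced_norm p F K C =
     (let U = unit_group (F\<lparr>carrier := K\<rparr>) in set_mult U (powers p U) (field_norm F K ` C))"


section \<open>Vector spaces over the prime field\<close>

text \<open>Additive maps between vector spaces over a prime field are linear, so these spaces are
  treated as abelian groups.\<close>

definition Fp_space :: "nat \<Rightarrow> nat \<Rightarrow> (nat \<Rightarrow> int) monoid" where
  "Fp_space p n = product_group {..<n} (\<lambda>_. integer_mod_group p)"

definition Fp_dim :: "nat \<Rightarrow> ('a, 'b) monoid_scheme \<Rightarrow> nat" where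
  "Fp_dim p V = (THE n. V \<cong> Fp_space p n)"

text \<open>The tensor product over the integers of two abelian groups (the second one written
  multiplicatively in the application): the free abelian group on pairs modulo bilinearity.\<close>

definition tensor :: "('a, 'c) monoid_scheme \<Rightarrow> ('b, 'd) monoid_scheme \<Rightarrow> ('a \<times> 'b \<Rightarrow>\<^sub>0 int) set monoid" where
  "tensor A B =
     (let S = carrier A \<times> carrier B in
      free_Abelian_group S Mod generate (free_Abelian_group S)
        ({frag_of (a \<otimes>\<^bsub>A\<^esub> a', b) - frag_of (a, b) - frag_of (a', b) | a a' b.
            a \<in> carrier A \<and> a' \<in> carrier A \<and> b \<in> carrier B} \<union>
         {frag_of (a, b \<otimes>\<^bsub>B\<^esub> b') - frag_of (a, b) - frag_of (a, b') | a b b'.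
            a \<in> carrier A \<and> b \<in> carrier B \<and> b' \<in> carrier B}))"

definition d_Fp :: "nat \<Rightarrow> ('a, 'b) monoid_scheme \<Rightarrow> nat" where
  "d_Fp p M = Fp_dim p (tensor (integer_mod_group p) M)"


section \<open>Group algebras and free submodules\<close>

text \<open>The group is meant to be finite: no finite-support condition is imposed.\<close>

definition group_algebra :: "('r, 'b) ring_scheme \<Rightarrow> ('g, 'c) monoid_scheme \<Rightarrow> ('g \<Rightarrow> 'r) ring" where
  "group_algebra R G =
     \<lparr>carrier = carrier G \<rightarrow>\<^sub>E carrier R,
      monoid.mult = \<lambda>a b. \<lambda>g\<in>carrier G. \<Oplus>\<^bsub>R\<^esub>h\<in>carrier G. a h \<otimes>\<^bsub>R\<^esub> b (inv\<^bsub>G\<^esub> h \<otimes>\<^bsub>G\<^esub> g),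
      one = \<lambda>g\<in>carrier G. if g = \<one>\<^bsub>G\<^esub> then \<one>\<^bsub>R\<^esub> else \<zero>\<^bsub>R\<^esub>,
      ring.zero = \<lambda>g\<in>carrier G. \<zero>\<^bsub>R\<^esub>,
      ring.add = \<lambda>a b. \<lambda>g\<in>carrier G. a g \<oplus>\<^bsub>R\<^esub> b g\<rparr>"

text \<open>The library's locale \<^locale>\<open>module\<close> requires a commutative ring of scalars, so only the record of
  modules and the locale \<^locale>\<open>submodule\<close>, which does not, are used. Here \<open>W\<close> is a submodule of \<open>M\<close>
  with a basis of \<open>t\<close> elements.\<close>

definition free_submodule ::
    "('r, 'b) ring_scheme \<Rightarrow> ('r, 'm, 'c) module_scheme \<Rightarrow> 'm set \<Rightarrow> nat \<Rightarrow> bool" where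
  "free_submodule R M W t \<longleftrightarrow> submodule W R M \<and>
     (\<exists>b \<in> {..<t} \<rightarrow> W.
        bij_betw (\<lambda>c. \<Oplus>\<^bsub>M\<^esub>i\<in>{..<t}. c i \<odot>\<^bsub>M\<^esub> b i) ({..<t} \<rightarrow>\<^sub>E carrier R) W)"

text \<open>The rank of a maximal free submodule; it does not depend on the choice of that submodule for
  finitely generated modules over the group algebra of a finite \<open>p\<close>-group over the field with \<open>p\<close>
  elements.\<close>

definition max_free_rank :: "('r, 'b) ring_scheme \<Rightarrow> ('r, 'm, 'c) module_scheme \<Rightarrow> nat" where
  "max_free_rank R M =
     (THE t. \<exists>W. free_submodule R M W t \<and> (\<forall>W' t'. free_submodule R M W' t' \<and> W \<subseteq> W' \<longrightarrow> W' = W))"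

definition Fp_group_algebra :: "nat \<Rightarrow> ('g, 'c) monoid_scheme \<Rightarrow> ('g \<Rightarrow> int) ring" where
  "Fp_group_algebra p G = group_algebra (residue_ring (int p)) G"

text \<open>The units modulo \<open>p\<close>-th powers as a module over the group algebra of the Galois group. The
  automorphism \<open>\<sigma>\<close> sends a coset \<open>C\<close> to its image \<open>\<sigma> ` C\<close>, and the scalar \<open>a\<close> sends \<open>C\<close> to the product
  of the \<open>(\<sigma> ` C) ^ a \<sigma>\<close>. The ring operations \<open>mult\<close> and \<open>one\<close> of the record play no role.\<close>

definition units_module ::
    "nat \<Rightarrow> ('a, 'b) ring_scheme \<Rightarrow> 'a set \<Rightarrow> (('a \<Rightarrow> 'a) \<Rightarrow> int, 'a set) module" where
  "units_module p F K =
     (let E = units_mod_powers p F in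
      \<lparr>carrier = carrier E, monoid.mult = undefined, one = undefined, ring.zero = \<one>\<^bsub>E\<^esub>, ring.add = monoid.mult E,
       module.smult = \<lambda>a C. \<Otimes>\<^bsub>E\<^esub>\<sigma>\<in>carrier (galois_group F K). (\<sigma> ` C) [^]\<^bsub>E\<^esub> a \<sigma>\<rparr>)"

definition t_G :: "nat \<Rightarrow> ('a, 'b) ring_scheme \<Rightarrow> 'a set \<Rightarrow> nat" where
  "t_G p F K = max_free_rank (Fp_group_algebra p (galois_group F K)) (units_module p F K)"


section \<open>Units of the base field that become powers\<close>

definition unit_kernel :: "nat \<Rightarrow> ('a, 'b) ring_scheme \<Rightarrow> 'a set \<Rightarrow> 'a set monoid" where
  "unit_kernel p F K =
     (let U = unit_group (F\<lparr>carrier := K\<rparr>) in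
      (U\<lparr>carrier := carrier U \<inter> powers p (unit_group F)\<rparr>) Mod powers p U)"

end

theory Submission
  imports Defs
begin

text \<open>Write \<open>E\<^sub>F\<close> and \<open>E\<^sub>K\<close> for the unit groups modulo \<open>p\<close>-th powers. The norm element of the group algebra acts
  on \<open>E\<^sub>F\<close> as the composite of the induced norm \<open>E\<^sub>F \<rightarrow> E\<^sub>K\<close> with the natural map \<open>E\<^sub>K \<rightarrow> E\<^sub>F\<close>, whose kernel
  is the quotient in the statement. Over a \<open>p\<close>-group, finitely many elements form a basis of a free
  submodule if and only if their norms are linearly independent, because a nonzero submodule of a free
  module contains a nonzero fixed vector and the fixed vectors are the multiples of the norm element.
  Hence the maximal free rank is the dimension of the image of the norm element, and it differs from \<open>t\<close>
  by the dimension of a subspace of that kernel. The kernel is finite because a unit \<open>x ^ p\<close> of the base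
  field is determined, up to \<open>p\<close>-th powers of units of that field, by the roots of unity
  \<open>\<sigma> x / x\<close>.\<close>



section \<open>Elementary abelian groups\<close>

text \<open>Finiteness comes from two sources: the image of the norm, which has p^t elements by
  hypothesis, and the p-th roots of unity in F. Dimensions are therefore compared as exponents of
  cardinalities: for a homomorphism on the image of the induced norm, the size of its image times
  the size of its kernel is p^t, and this yields both inequalities. Likewise, the uniqueness behind
  each definite description reduces to p^m = p^n. The group algebra is noncommutative in general, so
  freeness over it is traded for independence over F_p of all translates of a basis. The arithmetic
  enters at three points: algebraic integers are closed under products, so that units form a group;
  a fixed unit has a fixed inverse, so that the units of K are the fixed units of F; and X^p - 1 has
  finitely many roots.\<close>

locale elementary_abelian = comm_group V for V (structure) +
  fixes p :: nat
  assumes prime_p: "Factorial_Ring.prime p"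
    and exponent: "x \<in> carrier V \<Longrightarrow> x [^] p = \<one>"
begin

text \<open>Coefficients are integers used as exponents, and by \<open>int_pow_mod\<close> only
  their residues modulo p matter. Adding coefficients then needs no reduction, while
  \<open>coeffs\<close> provides one representative of each residue vector for counting.\<close>

definition lincomb :: "'i set \<Rightarrow> ('i \<Rightarrow> 'a) \<Rightarrow> ('i \<Rightarrow> int) \<Rightarrow> 'a" where
  "lincomb I b c = (\<Otimes>i\<in>I. b i [^] c i)"

definition independent :: "'i set \<Rightarrow> ('i \<Rightarrow> 'a) \<Rightarrow> bool" where
  "independent I b \<longleftrightarrow> (\<forall>c. lincomb I b c = \<one> \<longrightarrow> (\<forall>i\<in>I. int p dvd c i))"

definition span :: "'i set \<Rightarrow> ('i \<Rightarrow> 'a) \<Rightarrow> 'a set" where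
  "span I b = range (lincomb I b)"

abbreviation coeffs :: "'i set \<Rightarrow> ('i \<Rightarrow> int) set" where
  "coeffs I \<equiv> I \<rightarrow>\<^sub>E {0..<int p}"

lemma p_pos: "0 < int p"
  using prime_p prime_gt_0_nat by auto

lemma int_pow_mod: "x \<in> carrier V \<Longrightarrow> x [^] (k mod int p) = x [^] k"
proof -
  assume x: "x \<in> carrier V"
  have "x [^] k = x [^] (int p * (k div int p) + k mod int p)" by simp
  also have "\<dots> = (x [^] int p) [^] (k div int p) \<otimes> x [^] (k mod int p)"
    using x by (simp only: int_pow_mult int_pow_pow)
  also have "\<dots> = x [^] (k mod int p)"
    using x exponent by (simp add: int_pow_int)
  finally show ?thesis by simp
qed

lemma lincomb_closed [simp]: "b \<in> I \<rightarrow> carrier V \<Longrightarrow> lincomb I b c \<in> carrier V"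
  unfolding lincomb_def by (rule finprod_closed) auto

lemma lincomb_cong:
  assumes "b \<in> I \<rightarrow> carrier V" "\<And>i. i \<in> I \<Longrightarrow> b i = b' i" "\<And>i. i \<in> I \<Longrightarrow> c i mod int p = d i mod int p"
  shows "lincomb I b c = lincomb I b' d"
  unfolding lincomb_def
proof (rule finprod_cong')
  fix i assume "i \<in> I"
  then show "b i [^] c i = b' i [^] d i"
    using assms int_pow_mod[of "b i" "c i"] int_pow_mod[of "b i" "d i"] by (auto simp: Pi_iff)
next
  show "(\<lambda>i. b' i [^] d i) \<in> I \<rightarrow> carrier V"
    using assms(1,2) by (auto simp: Pi_iff)
qed simp

lemma lincomb_add:
  "b \<in> I \<rightarrow> carrier V \<Longrightarrow> lincomb I b (\<lambda>i. c i + d i) = lincomb I b c \<otimes> lincomb I b d"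
  unfolding lincomb_def
  by (simp add: Pi_iff int_pow_mult flip: finprod_multf cong: finprod_cong)

lemma lincomb_zero [simp]: "lincomb I b (\<lambda>_. 0) = \<one>"
  unfolding lincomb_def by simp

lemma lincomb_uminus:
  assumes "b \<in> I \<rightarrow> carrier V"
  shows "lincomb I b (\<lambda>i. - c i) = inv (lincomb I b c)"
proof -
  have "lincomb I b (\<lambda>i. - c i) \<otimes> lincomb I b c = \<one>"
    using lincomb_add[OF assms, of "\<lambda>i. - c i" c] by simp
  then show ?thesis using assms inv_equality by simp
qed

lemma lincomb_scale:
  assumes "b \<in> I \<rightarrow> carrier V"
  shows "lincomb I b (\<lambda>i. k * c i) = lincomb I b c [^] (k :: int)"
  using assms unfolding lincomb_def
proof (induction I rule: infinite_finite_induct)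
  case (insert j I)
  then show ?case
    by (simp add: int_pow_distrib int_pow_pow mult.commute[of k] Pi_def)
qed auto

lemma lincomb_in_subgroup:
  assumes "subgroup H V" "b \<in> I \<rightarrow> H"
  shows "lincomb I b c \<in> H"
  using assms(2) unfolding lincomb_def
proof (induction I rule: infinite_finite_induct)
  case (insert j I)
  have "H \<subseteq> carrier V" using assms(1) subgroup.subset by blast
  then have "b j [^] c j \<in> H" "b \<in> I \<rightarrow> carrier V" "b j \<in> carrier V"
    using insert subgroup_int_pow_closed[OF assms(1)] by auto
  then show ?case
    using insert subgroup.m_closed[OF assms(1)] by (auto simp: Pi_def)
qed (use assms(1) subgroup.one_closed in auto)

lemma lincomb_insert:
  assumes "finite I" "j \<notin> I" "b \<in> I \<rightarrow> carrier V" "m \<in> carrier V"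
  shows "lincomb (insert j I) (b(j := m)) c = m [^] c j \<otimes> lincomb I b c"
proof -
  have "lincomb (insert j I) (b(j := m)) c = m [^] c j \<otimes> lincomb I (b(j := m)) c"
    using assms unfolding lincomb_def by (subst finprod_insert) (auto simp: Pi_iff)
  moreover have "lincomb I (b(j := m)) c = lincomb I b c"
    using assms by (intro lincomb_cong) auto
  ultimately show ?thesis by simp
qed

lemma lincomb_of_generator:
  assumes "finite I" "j \<in> I" "b \<in> I \<rightarrow> carrier V"
  shows "lincomb I b (\<lambda>i. if i = j then 1 else 0) = b j"
proof -
  have "lincomb I b (\<lambda>i. if i = j then 1 else 0) = (\<Otimes>i\<in>I. if i = j then b i else \<one>)"
    unfolding lincomb_def using assms(3) by (intro finprod_cong') (auto simp: Pi_iff)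
  then show ?thesis using finprod_singleton_swap[OF assms(2,1,3)] by simp
qed

lemma span_generator: "finite I \<Longrightarrow> j \<in> I \<Longrightarrow> b \<in> I \<rightarrow> carrier V \<Longrightarrow> b j \<in> span I b"
  unfolding span_def by (metis lincomb_of_generator rangeI)

lemma subgroup_span: "b \<in> I \<rightarrow> carrier V \<Longrightarrow> subgroup (span I b) V"
proof (rule subgroupI)
  assume b: "b \<in> I \<rightarrow> carrier V"
  show "span I b \<subseteq> carrier V" "span I b \<noteq> {}" using b by (auto simp: span_def)
  show "inv x \<in> span I b" if "x \<in> span I b" for x
    using that b by (auto simp: span_def simp flip: lincomb_uminus)
  show "x \<otimes> y \<in> span I b" if "x \<in> span I b" "y \<in> span I b" for x y
    using that b by (auto simp: span_def simp flip: lincomb_add)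
qed

lemma span_subset_subgroup: "subgroup H V \<Longrightarrow> b \<in> I \<rightarrow> H \<Longrightarrow> span I b \<subseteq> H"
  unfolding span_def using lincomb_in_subgroup by blast

lemma span_eq_image_coeffs:
  assumes "b \<in> I \<rightarrow> carrier V"
  shows "span I b = lincomb I b ` coeffs I"
proof -
  have "lincomb I b c \<in> lincomb I b ` coeffs I" for c
  proof
    show "lincomb I b c = lincomb I b (\<lambda>i\<in>I. c i mod int p)"
      by (rule lincomb_cong) (use assms in auto)
  qed (use p_pos in auto)
  then show ?thesis by (auto simp: span_def)
qed

text \<open>Two coefficient vectors with the same value differ by a relation; conversely, a relation
  reduced modulo p has the same value as the zero vector. Independence thus takes the form in which
  bases are defined and spans are counted.\<close>

lemma independent_iff_inj_on:
  assumes b: "b \<in> I \<rightarrow> carrier V"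
  shows "independent I b \<longleftrightarrow> inj_on (lincomb I b) (coeffs I)"
proof
  assume ind: "independent I b"
  show "inj_on (lincomb I b) (coeffs I)"
  proof (rule inj_onI)
    fix c d assume c: "c \<in> coeffs I" and d: "d \<in> coeffs I" and eq: "lincomb I b c = lincomb I b d"
    have "lincomb I b (\<lambda>i. c i + - d i) = \<one>"
      using b eq by (simp only: lincomb_add lincomb_uminus) simp
    then have *: "int p dvd c i - d i" if "i \<in> I" for i
      using ind that unfolding independent_def by fastforce
    show "c = d"
    proof (rule PiE_ext[OF c d])
      fix i assume i: "i \<in> I"
      have "c i mod int p = d i mod int p" using * i by (simp add: mod_eq_dvd_iff)
      then show "c i = d i" using PiE_mem[OF c i] PiE_mem[OF d i] by simp
    qed
  qed
next
  assume inj: "inj_on (lincomb I b) (coeffs I)"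
  show "independent I b"
    unfolding independent_def
  proof (intro allI impI ballI)
    fix c i assume c: "lincomb I b c = \<one>" and i: "i \<in> I"
    have "lincomb I b (\<lambda>i\<in>I. c i mod int p) = lincomb I b c"
      by (rule lincomb_cong) (use b in auto)
    moreover have "lincomb I b (\<lambda>i\<in>I. 0) = lincomb I b (\<lambda>_. 0)"
      by (rule lincomb_cong) (use b in auto)
    ultimately have "(\<lambda>i\<in>I. c i mod int p) = (\<lambda>i\<in>I. 0)"
      using c p_pos by (intro inj_onD[OF inj]) auto
    then show "int p dvd c i" using i by (metis restrict_apply' dvd_eq_mod_eq_0)
  qed
qed

lemma card_span:
  assumes "finite I" "b \<in> I \<rightarrow> carrier V" "independent I b"
  shows "card (span I b) = p ^ card I"
proof -
  have "card (span I b) = card (coeffs I)"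
    using assms by (simp add: span_eq_image_coeffs independent_iff_inj_on card_image)
  then show ?thesis using assms(1) by (simp add: card_PiE)
qed

lemma finite_span: "finite I \<Longrightarrow> b \<in> I \<rightarrow> carrier V \<Longrightarrow> finite (span I b)"
  by (simp add: span_eq_image_coeffs finite_PiE)

text \<open>If the coefficient of \<open>m\<close> were prime to p, inverting it modulo p would
  express \<open>m\<close> by the other vectors. So it vanishes modulo p, and what remains is a
  relation among the old vectors.\<close>

lemma independent_insert:
  assumes "finite I" "j \<notin> I" "b \<in> I \<rightarrow> carrier V" "independent I b" "m \<in> carrier V" "m \<notin> span I b"
  shows "independent (insert j I) (b(j := m))"
  unfolding independent_def
proof (intro allI impI)
  fix c assume "lincomb (insert j I) (b(j := m)) c = \<one>"
  then have 1: "m [^] c j \<otimes> lincomb I b c = \<one>"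
    using lincomb_insert assms by metis
  have dvd: "int p dvd c j"
  proof (rule ccontr)
    assume "\<not> int p dvd c j"
    then have "coprime (c j) (int p)"
      using prime_p by (metis coprime_commute prime_imp_coprime prime_nat_int_transfer)
    then obtain u where u: "[c j * u = 1] (mod int p)"
      using cong_solve_coprime_int by blast
    have "m [^] c j = lincomb I b (\<lambda>i. - c i)"
      using 1 assms inv_equality[of "m [^] c j" "lincomb I b c"] by (simp add: lincomb_uminus)
    then have "(m [^] c j) [^] u = lincomb I b (\<lambda>i. u * - c i)"
      using assms by (simp add: lincomb_scale del: mult_minus_right)
    moreover have "(m [^] c j) [^] u = m"
      using u assms(5) int_pow_mod[of m "c j * u"] int_pow_mod[of m 1]
      by (simp add: int_pow_pow cong_def)
    ultimately show False using assms(6) by (auto simp: span_def)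
  qed
  then have "m [^] c j = \<one>"
    using int_pow_mod[OF assms(5), of "c j"] by simp
  then have "lincomb I b c = \<one>" using 1 assms by simp
  then show "\<forall>i\<in>insert j I. int p dvd c i" using assms(4) dvd unfolding independent_def by blast
qed

section \<open>Coordinates and dimension of a finite F_p-space\<close>

lemma lincomb_hom:
  assumes "finite I" "b \<in> I \<rightarrow> carrier V"
  shows "lincomb I b \<in> hom (product_group I (\<lambda>_. integer_mod_group p)) V"
proof (rule homI)
  fix c d
  show "lincomb I b (c \<otimes>\<^bsub>product_group I (\<lambda>_. integer_mod_group p)\<^esub> d) = lincomb I b c \<otimes> lincomb I b d"
    by (subst lincomb_add[symmetric, OF assms(2)], rule lincomb_cong) (use assms in auto)
qed (use assms in auto)

lemma carrier_coeff_group: "carrier (product_group I (\<lambda>_. integer_mod_group p)) = coeffs I"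
  using p_pos by (simp add: carrier_integer_mod_group)

text \<open>A longest independent family spans, and its combination map is then an isomorphism from
  coordinates. Lengths are bounded because n independent vectors span p^n elements.\<close>

lemma ex_iso_Fp_space:
  assumes "finite (carrier V)"
  shows "\<exists>n. V \<cong> Fp_space p n"
proof -
  let ?P = "\<lambda>n::nat. \<exists>b\<in>{..<n} \<rightarrow> carrier V. independent {..<n} b"
  have "?P 0" by (auto simp: independent_def)
  moreover have "\<forall>n. ?P n \<longrightarrow> n \<le> card (carrier V)"
  proof (intro allI impI)
    fix n assume "?P n"
    then obtain b where b: "b \<in> {..<n} \<rightarrow> carrier V" "independent {..<n} b" by blast
    have "n \<le> p ^ n" using prime_p by (simp add: prime_ge_2_nat order.strict_implies_order power_gt_expt)
    also have "\<dots> \<le> card (carrier V)"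
      using card_span[of "{..<n}" b] b card_mono[OF assms subgroup.subset[OF subgroup_span[OF b(1)]]]
      by simp
    finally show "n \<le> card (carrier V)" .
  qed
  ultimately obtain n where n: "?P n" and max: "\<forall>m. ?P m \<longrightarrow> m \<le> n"
    using Nat.ex_has_greatest_nat[of ?P 0 "card (carrier V)"] by auto
  then obtain b where b: "b \<in> {..<n} \<rightarrow> carrier V" "independent {..<n} b" by blast
  have "span {..<n} b = carrier V"
  proof (rule ccontr)
    assume "span {..<n} b \<noteq> carrier V"
    then obtain m where m: "m \<in> carrier V" "m \<notin> span {..<n} b"
      using subgroup.subset[OF subgroup_span[OF b(1)]] by blast
    have "?P (Suc n)"
      using independent_insert[of "{..<n}" n b m] b m by (auto simp: lessThan_Suc intro!: bexI[of _ "b(n := m)"])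
    then show False using max by fastforce
  qed
  then have "lincomb {..<n} b \<in> iso (Fp_space p n) V"
    using b lincomb_hom[of "{..<n}" b]
    by (simp add: iso_def bij_betw_def Fp_space_def span_eq_image_coeffs independent_iff_inj_on
        carrier_coeff_group del: carrier_product_group)
  then have "Fp_space p n \<cong> V" by (auto simp: is_iso_def)
  then show ?thesis
    using group.iso_sym[of "Fp_space p n" V] by (auto simp: Fp_space_def)
qed

end

lemma card_Fp_space: "0 < p \<Longrightarrow> card (carrier (Fp_space p n)) = p ^ n"
  by (simp add: Fp_space_def carrier_integer_mod_group card_PiE)

text \<open>Cardinalities separate the spaces \<open>Fp_space p n\<close>, so the definite
  description in \<open>Fp_dim\<close> denotes the given \<open>n\<close>.\<close>

lemma Fp_dim_eqI:
  assumes "1 < p" "V \<cong> Fp_space p n"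
  shows "Fp_dim p V = n"
  unfolding Fp_dim_def
proof (rule the_equality)
  show "V \<cong> Fp_space p n" by fact
next
  fix m assume "V \<cong> Fp_space p m"
  then have "card (carrier (Fp_space p m)) = card (carrier (Fp_space p n))"
    using assms(2) by (metis iso_same_card)
  then show "m = n" using assms(1) by (simp add: card_Fp_space)
qed


section \<open>Fixed points of p-groups\<close>

text \<open>The locale \<open>group_action\<close> asks for a homomorphism into the group of
  extensional bijections, hence the \<open>restrict\<close>. Bijectivity follows from the other
  conditions, since the inverse of \<open>g\<close> undoes the action of \<open>g\<close>.\<close>

lemma group_actionI:
  assumes "group G"
    and "\<And>g x. g \<in> carrier G \<Longrightarrow> x \<in> E \<Longrightarrow> a g x \<in> E"
    and "\<And>x. x \<in> E \<Longrightarrow> a \<one>\<^bsub>G\<^esub> x = x"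
    and "\<And>g h x. g \<in> carrier G \<Longrightarrow> h \<in> carrier G \<Longrightarrow> x \<in> E \<Longrightarrow> a (g \<otimes>\<^bsub>G\<^esub> h) x = a g (a h x)"
  shows "group_action G E (\<lambda>g. restrict (a g) E)"
proof -
  interpret group G by fact
  have bij: "restrict (a g) E \<in> Bij E" if g: "g \<in> carrier G" for g
  proof -
    have inv: "a g (a (inv\<^bsub>G\<^esub> g) x) = x" "a (inv\<^bsub>G\<^esub> g) (a g x) = x" if "x \<in> E" for x
      using assms(3)[OF that] assms(4)[OF g inv_closed[OF g] that] assms(4)[OF inv_closed[OF g] g that] g
      by (metis r_inv, metis l_inv)
    have "bij_betw (a g) E E"
    proof (rule bij_betw_byWitness)
      show "\<forall>x\<in>E. a (inv\<^bsub>G\<^esub> g) (a g x) = x" "\<forall>x\<in>E. a g (a (inv\<^bsub>G\<^esub> g) x) = x"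
        using inv by blast+
      show "a g ` E \<subseteq> E" "a (inv\<^bsub>G\<^esub> g) ` E \<subseteq> E"
        using assms(2) g inv_closed[OF g] by blast+
    qed
    then show ?thesis by (simp add: Bij_def)
  qed
  have "(\<lambda>g. restrict (a g) E) \<in> hom G (BijGroup E)"
  proof (rule homI)
    fix g h assume gh: "g \<in> carrier G" "h \<in> carrier G"
    have "restrict (a g) E \<otimes>\<^bsub>BijGroup E\<^esub> restrict (a h) E = compose E (restrict (a g) E) (restrict (a h) E)"
      by (simp add: BijGroup_def bij gh)
    also have "\<dots> = restrict (a (g \<otimes>\<^bsub>G\<^esub> h)) E"
      by (rule ext) (use gh assms(2)[of h] assms(4)[of g h] in \<open>simp add: compose_def restrict_def\<close>)
    finally show "restrict (a (g \<otimes>\<^bsub>G\<^esub> h)) E = restrict (a g) E \<otimes>\<^bsub>BijGroup E\<^esub> restrict (a h) E" by simp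
  qed (simp add: bij BijGroup_def)
  then show ?thesis
    unfolding group_action_def group_hom_def group_hom_axioms_def
    using group_BijGroup is_group by blast
qed

text \<open>Orbit counting: fixed points are the orbits of size one. Any other orbit has a size that
  divides p^n and differs from one, hence is a multiple of p, and these orbits partition the
  complement of the fixed points.\<close>

lemma (in group_action) prime_dvd_card_fixed_points:
  assumes "Factorial_Ring.prime (p :: nat)" "Coset.order G = p ^ n" "finite E" "p dvd card E"
  shows "p dvd card {x \<in> E. \<forall>g\<in>carrier G. \<phi> g x = x}"
proof -
  let ?Fix = "{x \<in> E. \<forall>g\<in>carrier G. \<phi> g x = x}"
  let ?C = "{U \<in> orbits G E \<phi>. card U \<noteq> 1}"
  have fixed: "card (orbit G \<phi> x) = 1 \<longleftrightarrow> x \<in> ?Fix" if x: "x \<in> E" for x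
  proof
    assume "card (orbit G \<phi> x) = 1"
    then have "orbit G \<phi> x = {x}"
      using orbit_refl[OF x] by (metis card_1_singletonE singletonD)
    then show "x \<in> ?Fix" using x by (auto simp: orbit_def)
  next
    assume "x \<in> ?Fix"
    then have "orbit G \<phi> x = {x}"
      using orbit_refl[OF x] by (auto simp: orbit_def)
    then show "card (orbit G \<phi> x) = 1" by simp
  qed
  have Un: "\<Union>?C = E - ?Fix"
  proof (intro equalityI subsetI)
    fix x assume "x \<in> \<Union>?C"
    then obtain U where U: "U \<in> orbits G E \<phi>" "card U \<noteq> 1" "x \<in> U" by blast
    then have x: "x \<in> E" using orbits_coverture by blast
    then have "U = orbit G \<phi> x"
      using disjoint_union[OF U(1), of "orbit G \<phi> x"] U(3) orbit_refl[OF x] by (auto simp: orbits_def)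
    then show "x \<in> E - ?Fix" using fixed[OF x] U(2) x by auto
  next
    fix x assume x: "x \<in> E - ?Fix"
    then have "orbit G \<phi> x \<in> orbits G E \<phi>" unfolding orbits_def by blast
    moreover have "card (orbit G \<phi> x) \<noteq> 1" using fixed[of x] x by blast
    ultimately show "x \<in> \<Union>?C" using orbit_refl[of x] x by blast
  qed
  have "p dvd card (\<Union>?C)"
  proof (rule dvd_partition)
    show "finite (\<Union>?C)" unfolding Un using assms(3) by simp
    show "\<forall>c\<in>?C. p dvd card c"
    proof
      fix c assume "c \<in> ?C"
      then obtain x where "x \<in> E" "c = orbit G \<phi> x" "card c \<noteq> 1" unfolding orbits_def by blast
      then have "card c dvd p ^ n" "card c \<noteq> 1"
        using orbit_stabilizer_theorem[of x] assms(2) by (auto intro: dvdI[OF sym])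
      then show "p dvd card c"
        using assms(1) divides_primepow_nat[of p "card c" n] by (cases "card c = 1") (auto simp: dvd_power)
    qed
    show "\<forall>c1\<in>?C. \<forall>c2\<in>?C. c1 \<noteq> c2 \<longrightarrow> c1 \<inter> c2 = {}"
      using disjoint_union by blast
  qed
  moreover have "card E = card ?Fix + card (\<Union>?C)"
    unfolding Un using assms(3) card_Diff_subset[of ?Fix E] card_mono[of E ?Fix] by simp
  ultimately show ?thesis using assms(4) by (simp add: dvd_add_left_iff)
qed


section \<open>Modular representations of p-groups\<close>

lemma (in comm_monoid) finprod_Times:
  assumes "finite I" "finite J" "f \<in> I \<times> J \<rightarrow> carrier G"
  shows "finprod G f (I \<times> J) = (\<Otimes>i\<in>I. \<Otimes>j\<in>J. f (i, j))"
  using assms(1,3)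
proof (induction I)
  case (insert i I)
  have "Pair i ` J = {i} \<times> J" by auto
  then have "finprod G f ({i} \<times> J) = (\<Otimes>j\<in>J. f (i, j))"
    using insert(4) finprod_reindex[of f "Pair i" J] by (auto simp: inj_on_def Pi_iff)
  moreover have "finprod G f (insert i I \<times> J) = finprod G f ({i} \<times> J) \<otimes> finprod G f (I \<times> J)"
    using insert(1,2,4) assms(2)
    by (subst finprod_Un_disjoint[symmetric]) (auto intro!: arg_cong[of _ _ "finprod G f"])
  moreover have "f \<in> I \<times> J \<rightarrow> carrier G" using insert(4) by auto
  ultimately show ?case
    using insert by (subst finprod_insert) (auto simp: Pi_iff intro!: finprod_closed)
qed simp

text \<open>Between monoids a multiplicative map need not preserve the unit, so this is assumed
  separately. It also settles infinite index sets, where both products are the unit by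
  convention.\<close>

lemma hom_finprod:
  assumes "comm_monoid G" "comm_monoid H" "h \<in> hom G H" "h \<one>\<^bsub>G\<^esub> = \<one>\<^bsub>H\<^esub>" "f \<in> I \<rightarrow> carrier G"
  shows "h (finprod G f I) = finprod H (\<lambda>i. h (f i)) I"
proof -
  interpret G: comm_monoid G by fact
  interpret H: comm_monoid H by fact
  show ?thesis
    using assms(5)
  proof (induction I rule: infinite_finite_induct)
    case (insert i I)
    then show ?case
      using hom_mult[OF assms(3)] hom_in_carrier[OF assms(3)] by (auto simp: Pi_iff)
  qed (use assms(4) in auto)
qed

locale modular_rep = elementary_abelian V p + \<Gamma>: group \<Gamma>
  for V :: "'v monoid" (structure) and p and \<Gamma> :: "('g, 'e) monoid_scheme" +
  fixes act :: "'g \<Rightarrow> 'v \<Rightarrow> 'v"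
  assumes act_hom: "\<sigma> \<in> carrier \<Gamma> \<Longrightarrow> act \<sigma> \<in> hom V V"
    and act_one: "x \<in> carrier V \<Longrightarrow> act \<one>\<^bsub>\<Gamma>\<^esub> x = x"
    and act_mult: "\<sigma> \<in> carrier \<Gamma> \<Longrightarrow> \<tau> \<in> carrier \<Gamma> \<Longrightarrow> x \<in> carrier V \<Longrightarrow>
      act (\<sigma> \<otimes>\<^bsub>\<Gamma>\<^esub> \<tau>) x = act \<sigma> (act \<tau> x)"
    and order_power: "\<exists>n. Coset.order \<Gamma> = p ^ n"
begin

text \<open>Built field by field like \<open>units_module\<close>, \<open>undefined\<close>
  included, so that the two records agree by unfolding when V is the group of units modulo p-th
  powers.\<close>

definition rep_module :: "('g \<Rightarrow> int, 'v) module" where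
  "rep_module = \<lparr>carrier = carrier V, monoid.mult = undefined, one = undefined, ring.zero = \<one>,
     ring.add = monoid.mult V, module.smult = \<lambda>a x. \<Otimes>\<sigma>\<in>carrier \<Gamma>. act \<sigma> x [^] a \<sigma>\<rparr>"

definition norm :: "'v \<Rightarrow> 'v" where
  "norm x = (\<Otimes>\<sigma>\<in>carrier \<Gamma>. act \<sigma> x)"

text \<open>The elements \<open>b i\<close> form a basis over the group algebra exactly when these t
  * |\<Gamma>| translates form a basis over F_p. Freeness is handled in this form
  throughout.\<close>

definition translates :: "(nat \<Rightarrow> 'v) \<Rightarrow> nat \<times> 'g \<Rightarrow> 'v" where
  "translates b = (\<lambda>(i, \<sigma>). act \<sigma> (b i))"

lemma finite_\<Gamma> [simp]: "finite (carrier \<Gamma>)"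
  using order_power p_pos by (metis \<Gamma>.order_gt_0_iff_finite of_nat_0_less_iff zero_less_power)

lemma act_closed [simp]: "\<sigma> \<in> carrier \<Gamma> \<Longrightarrow> x \<in> carrier V \<Longrightarrow> act \<sigma> x \<in> carrier V"
  using act_hom hom_in_carrier by metis

lemma act_group_hom: "\<sigma> \<in> carrier \<Gamma> \<Longrightarrow> group_hom V V (act \<sigma>)"
  using act_hom by unfold_locales auto

lemma act_lincomb:
  assumes "\<sigma> \<in> carrier \<Gamma>" "b \<in> I \<rightarrow> carrier V"
  shows "act \<sigma> (lincomb I b c) = lincomb I (\<lambda>i. act \<sigma> (b i)) c"
proof -
  interpret group_hom V V "act \<sigma>" using assms(1) by (rule act_group_hom)
  have "act \<sigma> (lincomb I b c) = (\<Otimes>i\<in>I. act \<sigma> (b i [^] c i))"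
    unfolding lincomb_def
    by (rule hom_finprod) (use assms homh hom_one in \<open>auto simp: Pi_iff comm_monoid_axioms\<close>)
  also have "\<dots> = lincomb I (\<lambda>i. act \<sigma> (b i)) c"
    unfolding lincomb_def using assms by (intro finprod_cong') (auto simp: Pi_iff hom_int_pow)
  finally show ?thesis .
qed

lemma norm_closed [simp]: "x \<in> carrier V \<Longrightarrow> norm x \<in> carrier V"
  unfolding norm_def by (rule finprod_closed) auto

lemma norm_hom: "norm \<in> hom V V"
proof (rule homI)
  fix x y assume "x \<in> carrier V" "y \<in> carrier V"
  then show "norm (x \<otimes> y) = norm x \<otimes> norm y"
    unfolding norm_def
    by (simp add: hom_mult[OF act_hom] flip: finprod_multf cong: finprod_cong)
qed simp

text \<open>Right multiplication by \<tau> permutes the factors of the norm.\<close>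

lemma norm_act:
  assumes \<tau>: "\<tau> \<in> carrier \<Gamma>" and x: "x \<in> carrier V"
  shows "norm (act \<tau> x) = norm x"
proof -
  have bij: "inj_on (\<lambda>\<sigma>. \<sigma> \<otimes>\<^bsub>\<Gamma>\<^esub> \<tau>) (carrier \<Gamma>)" "(\<lambda>\<sigma>. \<sigma> \<otimes>\<^bsub>\<Gamma>\<^esub> \<tau>) ` carrier \<Gamma> = carrier \<Gamma>"
    using \<tau> \<Gamma>.inj_on_multc \<Gamma>.surj_const_mult
    by (auto simp: image_iff) (metis \<Gamma>.inv_closed \<Gamma>.inv_solve_right \<Gamma>.m_closed)
  have "norm x = (\<Otimes>\<sigma>\<in>(\<lambda>\<sigma>. \<sigma> \<otimes>\<^bsub>\<Gamma>\<^esub> \<tau>) ` carrier \<Gamma>. act \<sigma> x)"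
    by (simp add: norm_def bij)
  also have "\<dots> = (\<Otimes>\<sigma>\<in>carrier \<Gamma>. act (\<sigma> \<otimes>\<^bsub>\<Gamma>\<^esub> \<tau>) x)"
    using x \<tau> by (intro finprod_reindex bij) auto
  also have "\<dots> = norm (act \<tau> x)"
    unfolding norm_def using x \<tau> by (intro finprod_cong') (auto simp: act_mult)
  finally show ?thesis by simp
qed

lemma norm_lincomb:
  assumes "b \<in> I \<rightarrow> carrier V"
  shows "norm (lincomb I b c) = lincomb I (\<lambda>i. norm (b i)) c"
proof -
  interpret group_hom V V norm using norm_hom by unfold_locales auto
  have "norm (lincomb I b c) = (\<Otimes>i\<in>I. norm (b i [^] c i))"
    unfolding lincomb_def
    by (rule hom_finprod) (use assms homh hom_one in \<open>auto simp: Pi_iff comm_monoid_axioms\<close>)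
  also have "\<dots> = lincomb I (\<lambda>i. norm (b i)) c"
    unfolding lincomb_def using assms by (intro finprod_cong') (auto simp: Pi_iff hom_int_pow)
  finally show ?thesis .
qed

section \<open>Relations among translates and relations among norms\<close>

lemma translates_closed:
  "b \<in> {..<t} \<rightarrow> carrier V \<Longrightarrow> translates b \<in> {..<t} \<times> carrier \<Gamma> \<rightarrow> carrier V"
  by (auto simp: translates_def Pi_iff)

lemma lincomb_translates:
  assumes "b \<in> {..<t} \<rightarrow> carrier V"
  shows "lincomb ({..<t} \<times> carrier \<Gamma>) (translates b) c =
    (\<Otimes>i\<in>{..<t}. \<Otimes>\<sigma>\<in>carrier \<Gamma>. act \<sigma> (b i) [^] c (i, \<sigma>))"
  unfolding lincomb_def translates_def
  using assms by (subst finprod_Times) (auto simp: Pi_iff)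

text \<open>The dictionary for everything below: a combination of norms is a combination of
  translates whose coefficients do not depend on the group element.\<close>

lemma lincomb_norm_translates:
  assumes b: "b \<in> {..<t} \<rightarrow> carrier V"
  shows "lincomb {..<t} (\<lambda>i. norm (b i)) c =
    lincomb ({..<t} \<times> carrier \<Gamma>) (translates b) (\<lambda>(i, \<sigma>). c i)"
proof -
  have "norm (b i) [^] c i = (\<Otimes>\<sigma>\<in>carrier \<Gamma>. act \<sigma> (b i) [^] c i)" if "i < t" for i
    unfolding norm_def
    by (rule hom_finprod[of V V "\<lambda>x. x [^] c i"])
      (use that b in \<open>auto simp: comm_monoid_axioms hom_def int_pow_distrib Pi_iff\<close>)
  then show ?thesis
    unfolding lincomb_translates[OF b] unfolding lincomb_def
    using b by (intro finprod_cong') (auto simp: Pi_iff intro!: finprod_closed)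
qed

text \<open>All translates of \<open>b i\<close> have the same norm as \<open>b i\<close>, so taking
  norms of combinations of translates produces exactly the combinations of the norms.\<close>

lemma norm_image_span_translates:
  assumes b: "b \<in> {..<t} \<rightarrow> carrier V"
  shows "norm ` span ({..<t} \<times> carrier \<Gamma>) (translates b) = span {..<t} (\<lambda>i. norm (b i))"
proof -
  have nb: "(\<lambda>i. norm (b i)) \<in> {..<t} \<rightarrow> carrier V" using b by (auto simp: Pi_iff)
  have *: "norm (lincomb ({..<t} \<times> carrier \<Gamma>) (translates b) c) =
      lincomb ({..<t} \<times> carrier \<Gamma>) (\<lambda>(i, \<sigma>). norm (b i)) c" for c
    unfolding norm_lincomb[OF translates_closed[OF b]]
    by (rule lincomb_cong) (use b in \<open>auto simp: translates_def norm_act Pi_iff\<close>)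
  have "lincomb ({..<t} \<times> carrier \<Gamma>) (\<lambda>(i, \<sigma>). norm (b i)) c \<in> span {..<t} (\<lambda>i. norm (b i))" for c
    using span_generator[OF _ _ nb] by (intro lincomb_in_subgroup subgroup_span nb) auto
  moreover have "lincomb {..<t} (\<lambda>i. norm (b i)) c \<in> norm ` span ({..<t} \<times> carrier \<Gamma>) (translates b)" for c
  proof -
    \<comment> \<open>A preimage is obtained by placing the whole coefficient at the identity, so
      that only \<open>b i\<close> itself occurs among its translates.\<close>
    let ?d = "\<lambda>(i, \<sigma>). if \<sigma> = \<one>\<^bsub>\<Gamma>\<^esub> then c i else 0"
    have "norm (lincomb ({..<t} \<times> carrier \<Gamma>) (translates b) ?d) =
        (\<Otimes>i\<in>{..<t}. \<Otimes>\<sigma>\<in>carrier \<Gamma>. if \<sigma> = \<one>\<^bsub>\<Gamma>\<^esub> then norm (b i) [^] c i else \<one>)"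
      unfolding * unfolding lincomb_def using b
      by (subst finprod_Times) (auto simp: Pi_iff if_distrib cong: if_cong intro!: finprod_cong' finprod_closed)
    also have "\<dots> = lincomb {..<t} (\<lambda>i. norm (b i)) c"
      unfolding lincomb_def using b by (intro finprod_cong') (auto simp: finprod_singleton_swap Pi_iff)
    finally show ?thesis
      unfolding span_def by (intro image_eqI[OF _ rangeI]) (rule sym)
  qed
  ultimately show ?thesis by (auto simp: span_def *)
qed

text \<open>A relation among the norms is a relation among the translates with constant
  coefficients; its coefficient at the identity is the one to be tested.\<close>

lemma independent_translates_imp:
  assumes b: "b \<in> {..<t} \<rightarrow> carrier V"
    and ind: "independent ({..<t} \<times> carrier \<Gamma>) (translates b)"
  shows "independent {..<t} (\<lambda>i. norm (b i))"
  unfolding independent_def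
proof (intro allI impI ballI)
  fix c i assume "lincomb {..<t} (\<lambda>i. norm (b i)) c = \<one>" "i \<in> {..<t}"
  then have "int p dvd (\<lambda>(i, \<sigma>). c i) (i, \<one>\<^bsub>\<Gamma>\<^esub>)"
    using ind unfolding lincomb_norm_translates[OF b] independent_def by fastforce
  then show "int p dvd c i" by simp
qed

text \<open>The left regular action of \<Gamma> on coefficient functions, restricted to the index
  set so that it preserves extensionality.\<close>

definition translate_coeffs :: "nat \<Rightarrow> 'g \<Rightarrow> (nat \<times> 'g \<Rightarrow> int) \<Rightarrow> nat \<times> 'g \<Rightarrow> int" where
  "translate_coeffs t \<tau> c = (\<lambda>(i, \<sigma>)\<in>{..<t} \<times> carrier \<Gamma>. c (i, inv\<^bsub>\<Gamma>\<^esub> \<tau> \<otimes>\<^bsub>\<Gamma>\<^esub> \<sigma>))"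

lemma translate_coeffs_closed:
  assumes "\<tau> \<in> carrier \<Gamma>" "c \<in> {..<t} \<times> carrier \<Gamma> \<rightarrow>\<^sub>E Y"
  shows "translate_coeffs t \<tau> c \<in> {..<t} \<times> carrier \<Gamma> \<rightarrow>\<^sub>E Y"
  using assms by (auto simp: translate_coeffs_def intro!: PiE_mem[OF assms(2)])

lemma translate_coeffs_zero:
  "\<tau> \<in> carrier \<Gamma> \<Longrightarrow> translate_coeffs t \<tau> (\<lambda>_\<in>{..<t} \<times> carrier \<Gamma>. 0) = (\<lambda>_\<in>{..<t} \<times> carrier \<Gamma>. 0)"
  by (rule ext) (auto simp: translate_coeffs_def)

lemma translate_coeffs_one:
  assumes "c \<in> extensional ({..<t} \<times> carrier \<Gamma>)"
  shows "translate_coeffs t \<one>\<^bsub>\<Gamma>\<^esub> c = c"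
  by (rule extensionalityI[OF _ assms]) (auto simp: translate_coeffs_def)

lemma translate_coeffs_mult:
  "\<sigma> \<in> carrier \<Gamma> \<Longrightarrow> \<tau> \<in> carrier \<Gamma> \<Longrightarrow>
    translate_coeffs t (\<sigma> \<otimes>\<^bsub>\<Gamma>\<^esub> \<tau>) c = translate_coeffs t \<sigma> (translate_coeffs t \<tau> c)"
  by (rule ext) (auto simp: translate_coeffs_def \<Gamma>.inv_mult_group \<Gamma>.m_assoc)

text \<open>Equivariance of the combination map: the substitution of \<tau>\<sigma> for \<sigma> in
  the index cancels the inverse of \<tau> in the coefficient. Hence \<Gamma> acts on the relations
  among the translates.\<close>

lemma lincomb_translate_coeffs:
  assumes b: "b \<in> {..<t} \<rightarrow> carrier V" and \<tau>: "\<tau> \<in> carrier \<Gamma>"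
  shows "lincomb ({..<t} \<times> carrier \<Gamma>) (translates b) (translate_coeffs t \<tau> c) =
    act \<tau> (lincomb ({..<t} \<times> carrier \<Gamma>) (translates b) c)"
proof -
  let ?S = "{..<t} \<times> carrier \<Gamma>" and ?h = "\<lambda>(i, \<sigma>). (i, \<tau> \<otimes>\<^bsub>\<Gamma>\<^esub> \<sigma>)"
  have inj: "inj_on ?h ?S" using \<tau> by (auto simp: inj_on_def)
  have surj: "?h ` ?S = ?S"
  proof (intro equalityI subsetI)
    fix x assume "x \<in> ?S"
    then show "x \<in> ?h ` ?S"
      using \<tau> by (intro image_eqI[of _ _ "(fst x, inv\<^bsub>\<Gamma>\<^esub> \<tau> \<otimes>\<^bsub>\<Gamma>\<^esub> snd x)"])
        (auto simp flip: \<Gamma>.m_assoc)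
  qed (use \<tau> in auto)
  have "lincomb ?S (translates b) (translate_coeffs t \<tau> c) =
      (\<Otimes>x\<in>?h ` ?S. translates b x [^] translate_coeffs t \<tau> c x)"
    by (simp only: surj lincomb_def)
  also have "\<dots> = (\<Otimes>x\<in>?S. translates b (?h x) [^] translate_coeffs t \<tau> c (?h x))"
    using \<tau> b by (intro finprod_reindex inj) (auto simp: translates_def Pi_iff)
  also have "\<dots> = (\<Otimes>x\<in>?S. act \<tau> (translates b x) [^] c x)"
    using \<tau> b by (intro finprod_cong')
      (auto simp: translates_def translate_coeffs_def act_mult Pi_iff simp flip: \<Gamma>.m_assoc)
  also have "\<dots> = act \<tau> (lincomb ?S (translates b) c)"
    using act_lincomb[OF \<tau> translates_closed[OF b]] by (simp add: lincomb_def)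
  finally show ?thesis .
qed

text \<open>If the translates are dependent, the relations among them form a nontrivial \<open>p\<close>-group on which
  \<open>\<Gamma>\<close> acts, so some nontrivial relation is fixed; its coefficients do not depend on the group element,
  so that it is a relation among the norms.\<close>

lemma independent_translates:
  assumes b: "b \<in> {..<t} \<rightarrow> carrier V"
    and ind: "independent {..<t} (\<lambda>i. norm (b i))"
  shows "independent ({..<t} \<times> carrier \<Gamma>) (translates b)"
proof -
  let ?S = "{..<t} \<times> carrier \<Gamma>"
  let ?P = "product_group ?S (\<lambda>_. integer_mod_group p)"
  \<comment> \<open>The relations with reduced coefficients form a subgroup of the finite group of
    coefficient functions, so \<open>E\<close> is finite of p-power order whatever the size of
    V.\<close>
  define E where "E = kernel ?P V (lincomb ?S (translates b))"
  let ?a = "translate_coeffs t"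
  note tb = translates_closed[OF b]
  have E_iff: "c \<in> E \<longleftrightarrow> c \<in> coeffs ?S \<and> lincomb ?S (translates b) c = \<one>" for c
    by (simp add: E_def kernel_def carrier_coeff_group del: carrier_product_group)
  interpret P: group ?P by simp
  interpret h: group_hom ?P V "lincomb ?S (translates b)"
    using lincomb_hom[OF _ tb] by unfold_locales simp
  interpret action: group_action \<Gamma> E "\<lambda>g. restrict (?a g) E"
  proof (rule group_actionI)
    fix g c assume g: "g \<in> carrier \<Gamma>" and c: "c \<in> E"
    have "?a g c \<in> coeffs ?S"
      using c g unfolding E_iff by (intro translate_coeffs_closed) simp_all
    moreover have "lincomb ?S (translates b) (?a g c) = \<one>"
      using c g lincomb_translate_coeffs[OF b g] act_group_hom[OF g] unfolding E_iff
      by (simp add: group_hom.hom_one)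
    ultimately show "?a g c \<in> E" unfolding E_iff by blast
  next
    fix c assume "c \<in> E"
    then show "?a \<one>\<^bsub>\<Gamma>\<^esub> c = c"
      unfolding E_iff by (intro translate_coeffs_one) (simp add: PiE_iff)
  next
    fix g h c assume "g \<in> carrier \<Gamma>" "h \<in> carrier \<Gamma>"
    then show "?a (g \<otimes>\<^bsub>\<Gamma>\<^esub> h) c = ?a g (?a h c)"
      by (rule translate_coeffs_mult)
  qed (rule \<Gamma>.is_group)
  have finE: "finite E"
  proof (rule finite_subset)
    show "E \<subseteq> coeffs ?S" using E_iff by blast
    show "finite (coeffs ?S)" by (simp add: finite_PiE)
  qed
  have sub: "subgroup E ?P" unfolding E_def by (rule h.subgroup_kernel)
  have one: "\<one>\<^bsub>?P\<^esub> \<in> E" using sub subgroup.one_closed by blast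
  define F where "F = {c \<in> E. \<forall>g\<in>carrier \<Gamma>. restrict (?a g) E c = c}"
  have trivial: "E = {\<one>\<^bsub>?P\<^esub>}"
  proof (rule ccontr)
    assume "E \<noteq> {\<one>\<^bsub>?P\<^esub>}"
    then have "card E \<noteq> 1" using one by (metis card_1_singletonE singletonD)
    moreover have "card E dvd p ^ card ?S"
    proof -
      have "card E dvd Coset.order ?P" using P.lagrange[OF sub] by (metis dvd_triv_right)
      then show ?thesis
        by (simp add: Coset.order_def carrier_coeff_group card_PiE del: carrier_product_group)
    qed
    ultimately have "p dvd card E"
      using prime_p by (auto simp: divides_primepow_nat dvd_power)
    moreover obtain n where "Coset.order \<Gamma> = p ^ n" using order_power by blast
    ultimately have "p dvd card F" unfolding F_def
      by (intro action.prime_dvd_card_fixed_points[OF prime_p _ finE])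
    moreover have "F \<subseteq> {\<one>\<^bsub>?P\<^esub>}"
    proof
      fix c assume "c \<in> F"
      then have c: "c \<in> E" and fixd: "\<forall>g\<in>carrier \<Gamma>. restrict (?a g) E c = c"
        unfolding F_def by blast+
      \<comment> \<open>Invariance under \<sigma>, evaluated at (i, \<sigma>), brings the group
        argument back to the identity.\<close>
      have const: "c (i, \<sigma>) = c (i, \<one>\<^bsub>\<Gamma>\<^esub>)" if "i < t" "\<sigma> \<in> carrier \<Gamma>" for i \<sigma>
      proof -
        have "?a \<sigma> c = c" using bspec[OF fixd that(2)] c by simp
        then have "c (i, \<sigma>) = ?a \<sigma> c (i, \<sigma>)" by simp
        then show ?thesis using that by (simp add: translate_coeffs_def)
      qed
      have "lincomb {..<t} (\<lambda>i. norm (b i)) (\<lambda>i. c (i, \<one>\<^bsub>\<Gamma>\<^esub>)) = lincomb ?S (translates b) c"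
        unfolding lincomb_norm_translates[OF b]
      proof (rule lincomb_cong[OF tb])
        fix x assume "x \<in> ?S"
        then obtain i \<sigma> where "x = (i, \<sigma>)" "i < t" "\<sigma> \<in> carrier \<Gamma>" by blast
        then show "(case x of (i, \<sigma>) \<Rightarrow> c (i, \<one>\<^bsub>\<Gamma>\<^esub>)) mod int p = c x mod int p"
          using const[of i \<sigma>] by simp
      qed simp
      then have dvd: "int p dvd c (i, \<sigma>)" if "i < t" "\<sigma> \<in> carrier \<Gamma>" for i \<sigma>
        using spec[OF ind[unfolded independent_def], of "\<lambda>i. c (i, \<one>\<^bsub>\<Gamma>\<^esub>)"] that c
        unfolding E_iff const[OF that] by simp
      have "c = \<one>\<^bsub>?P\<^esub>"
      proof
        fix x show "c x = \<one>\<^bsub>?P\<^esub> x"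
        proof (cases "x \<in> ?S")
          case True
          have "c x \<in> {0..<int p}"
            using c True PiE_mem[of c ?S "\<lambda>_. {0..<int p}" x] unfolding E_iff by blast
          moreover have "int p dvd c x" using dvd[of "fst x" "snd x"] True by auto
          ultimately have "c x = 0" using mod_pos_pos_trivial[of "c x" "int p"] by simp
          then show ?thesis using True by simp
        next
          case False
          have "c x = undefined" using c PiE_arb[of c ?S _ x] False unfolding E_iff by blast
          then show ?thesis using False by simp
        qed
      qed
      then show "c \<in> {\<one>\<^bsub>?P\<^esub>}" by blast
    qed
    moreover have "\<one>\<^bsub>?P\<^esub> \<in> F"
      using one translate_coeffs_zero unfolding F_def by simp
    \<comment> \<open>The zero relation is the only fixed one, so p would divide 1.\<close>
    ultimately have "F = {\<one>\<^bsub>?P\<^esub>}" "p dvd card F" by blast+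
    then show False using prime_p by simp
  qed
  have "inj_on (lincomb ?S (translates b)) (carrier ?P)"
    using trivial[unfolded E_def] h.trivial_ker_imp_inj by blast
  then show ?thesis
    unfolding independent_iff_inj_on[OF tb] carrier_coeff_group .
qed

end


section \<open>Free submodules\<close>

text \<open>Scalars are functions on the group, so a family of scalars is a curried coefficient
  function; uncurrying turns it into an element of \<open>coeffs\<close>, with the restriction
  making it extensional again.\<close>

lemma bij_betw_uncurry:
  "bij_betw (\<lambda>c. restrict (case_prod c) (I \<times> J)) (I \<rightarrow>\<^sub>E (J \<rightarrow>\<^sub>E Y)) (I \<times> J \<rightarrow>\<^sub>E Y)"
proof (rule bij_betw_byWitness[where f' = "\<lambda>d. \<lambda>i\<in>I. \<lambda>j\<in>J. d (i, j)"])
  show "\<forall>c\<in>I \<rightarrow>\<^sub>E (J \<rightarrow>\<^sub>E Y). (\<lambda>i\<in>I. \<lambda>j\<in>J. restrict (case_prod c) (I \<times> J) (i, j)) = c"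
  proof (rule ballI, rule ext)
    fix c i assume c: "c \<in> I \<rightarrow>\<^sub>E (J \<rightarrow>\<^sub>E Y)"
    show "(\<lambda>i\<in>I. \<lambda>j\<in>J. restrict (case_prod c) (I \<times> J) (i, j)) i = c i"
    proof (cases "i \<in> I")
      case True
      then have "c i \<in> J \<rightarrow>\<^sub>E Y" using c by (rule PiE_mem[rotated])
      then show ?thesis using True by (auto simp: fun_eq_iff PiE_iff extensional_def)
    next
      case False
      then show ?thesis using PiE_arb[OF c False] by simp
    qed
  qed
  show "\<forall>d\<in>I \<times> J \<rightarrow>\<^sub>E Y. restrict (\<lambda>(i, j). (\<lambda>i\<in>I. \<lambda>j\<in>J. d (i, j)) i j) (I \<times> J) = d"
    by (auto simp: fun_eq_iff PiE_iff extensional_def)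
  show "(\<lambda>c. restrict (case_prod c) (I \<times> J)) ` (I \<rightarrow>\<^sub>E (J \<rightarrow>\<^sub>E Y)) \<subseteq> I \<times> J \<rightarrow>\<^sub>E Y"
    by (intro image_subsetI restrict_PiE_iff[THEN iffD2] ballI) (auto simp: PiE_iff)
  show "(\<lambda>d. \<lambda>i\<in>I. \<lambda>j\<in>J. d (i, j)) ` (I \<times> J \<rightarrow>\<^sub>E Y) \<subseteq> I \<rightarrow>\<^sub>E (J \<rightarrow>\<^sub>E Y)"
    by (auto simp: PiE_iff)
qed

section \<open>Free submodules in terms of translates\<close>

context modular_rep
begin

lemma submodule_rep_module_iff:
  "submodule W R rep_module \<longleftrightarrow>
    subgroup W V \<and> (\<forall>a\<in>carrier R. \<forall>x\<in>W. a \<odot>\<^bsub>rep_module\<^esub> x \<in> W)"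
proof -
  have "subgroup W (add_monoid rep_module) \<longleftrightarrow> subgroup W V"
    by (simp add: subgroup_def m_inv_def rep_module_def)
  then show ?thesis by (auto simp: submodule_def submodule_axioms_def)
qed

lemma finsum_rep_module_eq_finprod: "finsum rep_module f I = finprod V f I"
  by (simp add: finsum_def finprod_def rep_module_def)

lemma carrier_Fp_group_algebra: "carrier (Fp_group_algebra p \<Gamma>) = carrier \<Gamma> \<rightarrow>\<^sub>E {0..<int p}"
proof -
  have "{0..int p - 1} = {0..<int p}" by auto
  then show ?thesis by (simp add: Fp_group_algebra_def group_algebra_def residue_ring_def)
qed

lemma smult_rep_module: "a \<odot>\<^bsub>rep_module\<^esub> x = lincomb (carrier \<Gamma>) (\<lambda>\<sigma>. act \<sigma> x) a"
  by (simp add: rep_module_def lincomb_def)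

lemma finsum_rep_module:
  assumes "b \<in> {..<t} \<rightarrow> carrier V"
  shows "(\<Oplus>\<^bsub>rep_module\<^esub>i\<in>{..<t}. c i \<odot>\<^bsub>rep_module\<^esub> b i) =
    lincomb ({..<t} \<times> carrier \<Gamma>) (translates b) (restrict (case_prod c) ({..<t} \<times> carrier \<Gamma>))"
proof -
  have "(\<Oplus>\<^bsub>rep_module\<^esub>i\<in>{..<t}. c i \<odot>\<^bsub>rep_module\<^esub> b i) =
      lincomb ({..<t} \<times> carrier \<Gamma>) (translates b) (case_prod c)"
    by (subst lincomb_translates[OF assms]) (simp add: finsum_rep_module_eq_finprod smult_rep_module lincomb_def)
  also have "\<dots> = lincomb ({..<t} \<times> carrier \<Gamma>) (translates b) (restrict (case_prod c) ({..<t} \<times> carrier \<Gamma>))"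
    by (rule lincomb_cong[OF translates_closed[OF assms]]) auto
  finally show ?thesis .
qed

text \<open>By equivariance the span is stable under \<Gamma>. A scalar acts by a product of powers
  of translates of a vector, which stays in any \<Gamma>-stable subgroup.\<close>

lemma submodule_span_translates:
  assumes b: "b \<in> {..<t} \<rightarrow> carrier V"
  shows "submodule (span ({..<t} \<times> carrier \<Gamma>) (translates b)) (Fp_group_algebra p \<Gamma>) rep_module"
proof -
  let ?W = "span ({..<t} \<times> carrier \<Gamma>) (translates b)"
  have W: "subgroup ?W V" by (rule subgroup_span[OF translates_closed[OF b]])
  have "act \<sigma> x \<in> ?W" if "\<sigma> \<in> carrier \<Gamma>" "x \<in> ?W" for \<sigma> x
    using that lincomb_translate_coeffs[OF b that(1)] by (auto simp: span_def simp flip: lincomb_translate_coeffs[OF b])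
  then show ?thesis
    unfolding submodule_rep_module_iff smult_rep_module
    using W by (auto intro!: lincomb_in_subgroup[OF W])
qed

text \<open>The basis map of \<open>free_submodule\<close> is uncurrying followed by the combination
  map of the translates. Since uncurrying is bijective, the basis map is bijective onto W if and
  only if the translates are independent and span W.\<close>

lemma free_submodule_iff:
  "free_submodule (Fp_group_algebra p \<Gamma>) rep_module W t \<longleftrightarrow>
    (\<exists>b\<in>{..<t} \<rightarrow> carrier V. independent ({..<t} \<times> carrier \<Gamma>) (translates b) \<and>
       W = span ({..<t} \<times> carrier \<Gamma>) (translates b))"
    (is "?L \<longleftrightarrow> ?R")
proof -
  let ?S = "{..<t} \<times> carrier \<Gamma>"
  have bij: "bij_betw (\<lambda>c. \<Oplus>\<^bsub>rep_module\<^esub>i\<in>{..<t}. c i \<odot>\<^bsub>rep_module\<^esub> b i)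
        ({..<t} \<rightarrow>\<^sub>E carrier (Fp_group_algebra p \<Gamma>)) W \<longleftrightarrow>
      independent ?S (translates b) \<and> W = span ?S (translates b)"
    if b: "b \<in> {..<t} \<rightarrow> carrier V" for b
  proof -
    let ?u = "\<lambda>c. restrict (case_prod c) ?S"
    have "bij_betw (lincomb ?S (translates b) \<circ> ?u) ({..<t} \<rightarrow>\<^sub>E (carrier \<Gamma> \<rightarrow>\<^sub>E {0..<int p})) W \<longleftrightarrow>
        bij_betw (lincomb ?S (translates b)) (coeffs ?S) W"
      by (rule bij_betw_comp_iff[OF bij_betw_uncurry, symmetric])
    then show ?thesis
      using translates_closed[OF b]
      by (auto simp: finsum_rep_module[OF b] carrier_Fp_group_algebra comp_def bij_betw_def
          independent_iff_inj_on span_eq_image_coeffs)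
  qed
  show ?thesis
  proof
    assume ?L
    then obtain b where W: "submodule W (Fp_group_algebra p \<Gamma>) rep_module" and b: "b \<in> {..<t} \<rightarrow> W"
      and "bij_betw (\<lambda>c. \<Oplus>\<^bsub>rep_module\<^esub>i\<in>{..<t}. c i \<odot>\<^bsub>rep_module\<^esub> b i)
        ({..<t} \<rightarrow>\<^sub>E carrier (Fp_group_algebra p \<Gamma>)) W"
      unfolding free_submodule_def by blast
    moreover have "W \<subseteq> carrier V"
      using W subgroup.subset[of W V] by (simp add: submodule_rep_module_iff)
    ultimately show ?R using bij[of b] by (intro bexI[of _ b]) auto
  next
    assume ?R
    then obtain b where b: "b \<in> {..<t} \<rightarrow> carrier V" "independent ?S (translates b)" "W = span ?S (translates b)"
      by blast
    \<comment> \<open>The element \<open>b i\<close> is its own translate by the identity.\<close>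
    have "b i \<in> W" if "i < t" for i
      using span_generator[of ?S "(i, \<one>\<^bsub>\<Gamma>\<^esub>)" "translates b"] translates_closed[OF b(1)] that b
      by (auto simp: translates_def act_one Pi_iff)
    then show ?L
      unfolding free_submodule_def using b submodule_span_translates[OF b(1)] bij[OF b(1)] by blast
  qed
qed

text \<open>The size of W serves to compare nested free submodules; the size of its norm image ties
  the rank to the norm.\<close>

lemma free_submodule_card:
  assumes "free_submodule (Fp_group_algebra p \<Gamma>) rep_module W t"
  shows "W \<subseteq> carrier V" "finite W" "card W = p ^ (t * Coset.order \<Gamma>)" "card (norm ` W) = p ^ t"
proof -
  let ?S = "{..<t} \<times> carrier \<Gamma>"
  obtain b where b: "b \<in> {..<t} \<rightarrow> carrier V" and ind: "independent ?S (translates b)"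
    and W: "W = span ?S (translates b)"
    using assms unfolding free_submodule_iff by blast
  note tb = translates_closed[OF b]
  show "W \<subseteq> carrier V" using subgroup.subset[OF subgroup_span[OF tb]] W by simp
  show "finite W" using finite_span[OF _ tb] W by simp
  show "card W = p ^ (t * Coset.order \<Gamma>)"
    using card_span[OF _ tb ind] W by (simp add: card_cartesian_product Coset.order_def)
  have "(\<lambda>i. norm (b i)) \<in> {..<t} \<rightarrow> carrier V" using b by (auto simp: Pi_iff)
  then show "card (norm ` W) = p ^ t"
    using card_span[OF _ _ independent_translates_imp[OF b ind]] W norm_image_span_translates[OF b] by simp
qed

text \<open>The norms of a basis of W span the norms of W, so adjoining \<open>m\<close> keeps the
  norms independent, and then also the translates.\<close>

lemma free_submodule_extend:
  assumes "free_submodule (Fp_group_algebra p \<Gamma>) rep_module W t" and m: "m \<in> carrier V" "norm m \<notin> norm ` W"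
  shows "\<exists>W'. free_submodule (Fp_group_algebra p \<Gamma>) rep_module W' (Suc t) \<and> insert m W \<subseteq> W'"
proof -
  let ?S = "{..<t} \<times> carrier \<Gamma>" and ?S' = "{..<Suc t} \<times> carrier \<Gamma>"
  obtain b where b: "b \<in> {..<t} \<rightarrow> carrier V" and ind: "independent ?S (translates b)"
    and W: "W = span ?S (translates b)"
    using assms(1) unfolding free_submodule_iff by blast
  let ?b' = "b(t := m)"
  have b': "?b' \<in> {..<Suc t} \<rightarrow> carrier V" using b m by (auto simp: Pi_iff less_Suc_eq)
  have nb: "(\<lambda>i. norm (b i)) \<in> {..<t} \<rightarrow> carrier V" using b by (auto simp: Pi_iff)
  have "independent (insert t {..<t}) ((\<lambda>i. norm (b i))(t := norm m))"
    using m W norm_image_span_translates[OF b]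
    by (intro independent_insert nb independent_translates_imp[OF b ind]) auto
  also have "insert t {..<t} = {..<Suc t}" by auto
  also have "(\<lambda>i. norm (b i))(t := norm m) = (\<lambda>i. norm (?b' i))" by auto
  finally have "independent ?S' (translates ?b')" by (rule independent_translates[OF b'])
  then have "free_submodule (Fp_group_algebra p \<Gamma>) rep_module (span ?S' (translates ?b')) (Suc t)"
    unfolding free_submodule_iff using b' by blast
  moreover have gen: "translates ?b' x \<in> span ?S' (translates ?b')" if "x \<in> ?S'" for x
    using that by (intro span_generator translates_closed[OF b']) auto
  have "W \<subseteq> span ?S' (translates ?b')"
    unfolding W
  proof (rule span_subset_subgroup)
    show "subgroup (span ?S' (translates ?b')) V" by (rule subgroup_span[OF translates_closed[OF b']])
    show "translates b \<in> ?S \<rightarrow> span ?S' (translates ?b')"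
    proof
      fix x assume "x \<in> ?S"
      then show "translates b x \<in> span ?S' (translates ?b')"
        using gen[of x] by (auto simp: translates_def)
    qed
  qed
  moreover have "m \<in> span ?S' (translates ?b')"
    using gen[of "(t, \<one>\<^bsub>\<Gamma>\<^esub>)"] m by (simp add: translates_def act_one)
  ultimately show ?thesis by blast
qed

text \<open>An inclusion-maximal free submodule attains every norm, since an element with a missed
  norm would enlarge it; its rank is then forced by the size of the norm image. Existence follows by
  taking the greatest rank, which the size of the norm image bounds.\<close>

theorem power_max_free_rank:
  assumes fin: "finite (norm ` carrier V)"
  shows "p ^ max_free_rank (Fp_group_algebra p \<Gamma>) rep_module = card (norm ` carrier V)"
proof -
  let ?free = "free_submodule (Fp_group_algebra p \<Gamma>) rep_module"
  let ?max = "\<lambda>W t. ?free W t \<and> (\<forall>W' t'. ?free W' t' \<and> W \<subseteq> W' \<longrightarrow> W' = W)"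
  have p1: "1 < p" by (rule prime_gt_1_nat[OF prime_p])
  have card_max: "p ^ t = card (norm ` carrier V)" if max: "?max W t" for W t
  proof -
    have "norm m \<in> norm ` W" if m: "m \<in> carrier V" for m
    proof (rule ccontr)
      assume "norm m \<notin> norm ` W"
      then obtain W' where "?free W' (Suc t)" "insert m W \<subseteq> W'"
        using free_submodule_extend[of W t m] max m by auto
      then have "m \<in> W" using conjunct2[OF max] by blast
      then show False using \<open>norm m \<notin> norm ` W\<close> by blast
    qed
    then have "norm ` W = norm ` carrier V"
      using free_submodule_card(1)[of W t] max by blast
    then show ?thesis using free_submodule_card(4)[of W t] max by simp
  qed
  have "\<exists>t W. ?max W t"
  proof -
    let ?P = "\<lambda>t. \<exists>W. ?free W t"
    have "?P 0" unfolding free_submodule_iff by (auto simp: independent_def)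
    moreover have "t \<le> card (norm ` carrier V)" if t: "?P t" for t
    proof -
      obtain W where "?free W t" using t by blast
      then have "p ^ t \<le> card (norm ` carrier V)"
        using free_submodule_card(1,4)[of W t] card_mono[OF fin image_mono, of W] by simp
      moreover have "t < p ^ t" using p1 by (simp add: power_gt_expt)
      ultimately show ?thesis by simp
    qed
    ultimately obtain t where t: "?P t" "\<forall>s. ?P s \<longrightarrow> s \<le> t"
      using Nat.ex_has_greatest_nat[of ?P 0 "card (norm ` carrier V)"] by blast
    then obtain W where W: "?free W t" by blast
    \<comment> \<open>Greatest rank implies maximality for inclusion: a free submodule above W has
      rank at most t, hence no more elements than W.\<close>
    have "W' = W" if W': "?free W' t'" "W \<subseteq> W'" for W' t'
    proof -
      have "t' \<le> t" using t W' by blast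
      then have "card W' \<le> card W"
        using free_submodule_card(3)[OF W] free_submodule_card(3)[OF W'(1)] p1 by simp
      then show ?thesis using card_seteq[OF free_submodule_card(2)[OF W'(1)] W'(2)] by simp
    qed
    then show ?thesis using W by blast
  qed
  then obtain t where t: "\<exists>W. ?max W t" by blast
  have "max_free_rank (Fp_group_algebra p \<Gamma>) rep_module = t"
    unfolding max_free_rank_def
  proof (rule the_equality[where P = "\<lambda>t. \<exists>W. ?max W t", OF t])
    fix s assume "\<exists>W. ?max W s"
    then have "p ^ s = p ^ t" using card_max t by metis
    then show "s = t" using p1 by simp
  qed
  then show ?thesis using card_max t by blast
qed

end


section \<open>Tensor product with the prime field\<close>

text \<open>The map \<open>k\<close> sends b to the class of (1, b). It is onto because (a, b) and
  (1, b^a) have the same class, and injective because the map \<open>h\<close> determined by (a, b)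
  -> b^a kills the bilinearity relations. Exponent p is what makes b^a additive in the residue
  a.\<close>

lemma (in elementary_abelian) iso_tensor: "V \<cong> tensor (integer_mod_group p) V"
proof -
  let ?S = "{0..<int p} \<times> carrier V"
  let ?Fr = "free_Abelian_group ?S"
  let ?R1 = "{frag_of ((a + a') mod int p, b) - frag_of (a, b) - frag_of (a', b) | a a' b.
      a \<in> {0..<int p} \<and> a' \<in> {0..<int p} \<and> b \<in> carrier V}"
  let ?R2 = "{frag_of (a, b \<otimes> b') - frag_of (a, b) - frag_of (a, b') | a b b'.
      a \<in> {0..<int p} \<and> b \<in> carrier V \<and> b' \<in> carrier V}"
  define N where "N = generate ?Fr (?R1 \<union> ?R2)"
  have Z: "carrier (integer_mod_group p) = {0..<int p}"
    using p_pos by (simp add: carrier_integer_mod_group)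
  have tensor: "tensor (integer_mod_group p) V = ?Fr Mod N"
    unfolding tensor_def Let_def N_def Z mult_integer_mod_group ..
  have p1: "1 < int p" using prime_gt_1_nat[OF prime_p] by linarith
  interpret Fr: comm_group ?Fr by (rule abelian_free_Abelian_group)
  have R: "?R1 \<union> ?R2 \<subseteq> carrier ?Fr"
    using p_pos by (auto dest!: subsetD[OF keys_diff])
  have sub: "subgroup N ?Fr" unfolding N_def by (rule Fr.generate_is_subgroup[OF R])
  interpret N: normal N ?Fr using Fr.normal_iff_subgroup sub by blast
  define Q where "Q = ?Fr Mod N"
  interpret Q: comm_group Q unfolding Q_def by (rule Fr.abelian_FactGroup[OF sub])
  define c where "c x = N #>\<^bsub>?Fr\<^esub> x" for x
  have c_hom: "c \<in> hom ?Fr Q" unfolding c_def Q_def by (rule N.r_coset_hom_Mod)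
  interpret c: group_hom ?Fr Q c
    using c_hom by unfold_locales
  have c_split: "c x = c y \<otimes>\<^bsub>Q\<^esub> c z"
    if "x - y - z \<in> ?R1 \<union> ?R2" "x \<in> carrier ?Fr" "y \<in> carrier ?Fr" "z \<in> carrier ?Fr" for x y z
  proof -
    have N: "x - y - z \<in> N" using that(1) unfolding N_def by (rule generate.incl)
    then have "c (x - y - z) = \<one>\<^bsub>Q\<^esub>"
      unfolding c_def Q_def using Fr.coset_join2[OF _ sub] N.mem_carrier by simp
    moreover have "c ((x - y - z) \<otimes>\<^bsub>?Fr\<^esub> (y \<otimes>\<^bsub>?Fr\<^esub> z)) = c (x - y - z) \<otimes>\<^bsub>Q\<^esub> (c y \<otimes>\<^bsub>Q\<^esub> c z)"
      using that N.mem_carrier[OF N] by (simp only: c.hom_mult Fr.m_closed)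
    ultimately show ?thesis
      using that(2-) Q.m_closed[OF c.hom_closed c.hom_closed] by simp
  qed
  have c_add: "c (frag_of ((a + a') mod int p, b)) = c (frag_of (a, b)) \<otimes>\<^bsub>Q\<^esub> c (frag_of (a', b))"
    if "a \<in> {0..<int p}" "a' \<in> {0..<int p}" "b \<in> carrier V" for a a' b
    by (rule c_split) (use that p_pos in auto)
  have c_mult: "c (frag_of (a, b \<otimes> b')) = c (frag_of (a, b)) \<otimes>\<^bsub>Q\<^esub> c (frag_of (a, b'))"
    if "a \<in> {0..<int p}" "b \<in> carrier V" "b' \<in> carrier V" for a b b'
    by (rule c_split) (use that p_pos in auto)
  define k where "k b = c (frag_of (1, b))" for b
  have k_hom: "k \<in> hom V (Q)"
    unfolding k_def using p1 c_mult[of 1] by (intro homI c.hom_closed) auto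
  interpret k: group_hom V Q k using k_hom by unfold_locales
  \<comment> \<open>The residue grows by 1 and stays below p, so no reduction occurs. The class of
    (0, b) is idempotent, hence trivial.\<close>
  have c_generator: "c (frag_of (int n, b)) = k (b [^] n)" if "int n < int p" "b \<in> carrier V" for n b
    using that(1)
  proof (induction n)
    case 0
    have "c (frag_of (0, b)) = c (frag_of (0, b)) \<otimes>\<^bsub>Q\<^esub> c (frag_of (0, b))"
      using c_add[of 0 0 b] that p_pos by simp
    then show ?case using that p_pos by simp
  next
    case (Suc n)
    have "c (frag_of (int (Suc n), b)) = c (frag_of (int n, b)) \<otimes>\<^bsub>Q\<^esub> k b"
      using c_add[of "int n" 1 b] Suc(2) that(2) p1 by (simp add: k_def add.commute)
    then show ?case using Suc that(2) by simp
  qed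
  have "c x \<in> k ` carrier V" if "Poly_Mapping.keys x \<subseteq> ?S" for x
  proof (rule free_Abelian_group_induct[OF that, where P = "\<lambda>x. c x \<in> k ` carrier V"])
    have "c 0 = k \<one>" using c.hom_one by simp
    then show "c 0 \<in> k ` carrier V" by blast
  next
    fix x y
    assume 2: "Poly_Mapping.keys x \<subseteq> ?S" "Poly_Mapping.keys y \<subseteq> ?S"
      "c x \<in> k ` carrier V" "c y \<in> k ` carrier V"
    then obtain b b' where b: "b \<in> carrier V" "c x = k b" "b' \<in> carrier V" "c y = k b'" by blast
    have carrier: "x \<in> carrier ?Fr" "y \<in> carrier ?Fr" using 2 by simp_all
    have "c (x - y) = c (x \<otimes>\<^bsub>?Fr\<^esub> inv\<^bsub>?Fr\<^esub> y)" using 2 by simp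
    also have "\<dots> = k (b \<otimes> inv b')"
      using b carrier by (simp only: c.hom_mult c.hom_inv Fr.inv_closed k.hom_mult k.hom_inv inv_closed)
    finally show "c (x - y) \<in> k ` carrier V" using b by blast
  next
    fix x assume "x \<in> ?S"
    then obtain a b where x: "x = (a, b)" "0 \<le> a" "a < int p" "b \<in> carrier V" by auto
    then have "c (frag_of x) = k (b [^] nat a)" using c_generator[of "nat a" b] by simp
    then show "c (frag_of x) \<in> k ` carrier V" using x by blast
  qed
  then have surj: "k ` carrier V = carrier (Q)"
    using k.hom_closed by (auto simp: Q_def carrier_FactGroup c_def)
  have "(\<lambda>(a, b). b [^] a) ` ?S \<subseteq> carrier V" by auto
  then obtain h where h: "h \<in> hom ?Fr V" "\<And>x. x \<in> ?S \<Longrightarrow> h (frag_of x) = (case x of (a, b) \<Rightarrow> b [^] a)"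
    by (rule free_Abelian_group_universal) blast
  interpret h: group_hom ?Fr V h using h(1) by unfold_locales
  have h_diff: "h (x - y) = h x \<otimes> inv (h y)" if "x \<in> carrier ?Fr" "y \<in> carrier ?Fr" for x y
  proof -
    have "h (x - y) = h (x \<otimes>\<^bsub>?Fr\<^esub> inv\<^bsub>?Fr\<^esub> y)" using that by simp
    then show ?thesis using that by (simp only: h.hom_mult h.hom_inv Fr.inv_closed)
  qed
  have h_rel: "h (x - y - z) = \<one>"
    if "x \<in> carrier ?Fr" "y \<in> carrier ?Fr" "z \<in> carrier ?Fr" "h x = h y \<otimes> h z" for x y z
  proof -
    have "x - y \<in> carrier ?Fr" using that by (auto dest!: subsetD[OF keys_diff])
    then have "h (x - y - z) = (h y \<otimes> h z) \<otimes> inv (h y) \<otimes> inv (h z)"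
      using that by (simp only: h_diff)
    also have "\<dots> = \<one>"
      using that h.hom_closed[of y] h.hom_closed[of z] by (simp add: m_comm[of "h y" "h z"] m_assoc)
    finally show ?thesis .
  qed
  have "?R1 \<union> ?R2 \<subseteq> kernel ?Fr V h"
  proof
    fix r assume r: "r \<in> ?R1 \<union> ?R2"
    then have "h r = \<one>"
      by (elim UnE CollectE exE conjE; simp only:; intro h_rel)
        (use p_pos in \<open>auto simp: h(2) int_pow_mod int_pow_mult int_pow_distrib\<close>)
    then show "r \<in> kernel ?Fr V h" using subsetD[OF R r] unfolding kernel_def by blast
  qed
  then have ker: "N \<subseteq> kernel ?Fr V h"
    unfolding N_def by (intro Fr.generate_subgroup_incl h.subgroup_kernel)
  have "b = b'" if "b \<in> carrier V" "b' \<in> carrier V" "k b = k b'" for b b'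
  proof -
    have f: "frag_of (1, b) \<in> carrier ?Fr" "frag_of (1, b') \<in> carrier ?Fr" using that p1 by auto
    \<comment> \<open>Equal classes differ by an element of \<open>N\<close>, which \<open>h\<close>
      kills, while \<open>h\<close> recovers b from (1, b).\<close>
    have "frag_of (1, b) \<in> N #>\<^bsub>?Fr\<^esub> frag_of (1, b')"
      using that(3) Fr.rcos_self[OF f(1) sub] by (simp add: k_def c_def)
    then obtain n where n: "n \<in> N" "frag_of (1, b) = n \<otimes>\<^bsub>?Fr\<^esub> frag_of (1, b')"
      by (auto simp: r_coset_def)
    then have "h (frag_of (1, b)) = h n \<otimes> h (frag_of (1, b'))"
      using f N.mem_carrier by (metis h.hom_mult)
    moreover have "h n = \<one>" using n ker by (auto simp: kernel_def)
    ultimately show ?thesis using that p1 by (simp add: h(2))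
  qed
  then have "k \<in> iso V (Q)"
    using surj k_hom by (auto simp: iso_def bij_betw_def inj_on_def)
  then show ?thesis unfolding tensor Q_def by (auto simp: is_iso_def)
qed

lemma (in elementary_abelian) power_d_Fp:
  assumes "finite (carrier V)"
  shows "p ^ d_Fp p V = card (carrier V)"
proof -
  let ?T = "tensor (integer_mod_group p) V"
  have p1: "1 < p" by (rule prime_gt_1_nat[OF prime_p])
  obtain n where n: "V \<cong> Fp_space p n" using ex_iso_Fp_space[OF assms] by blast
  have "?T \<cong> V" by (rule iso_sym[OF iso_tensor])
  then have "?T \<cong> Fp_space p n" using n iso_trans by blast
  then have "d_Fp p V = n" unfolding d_Fp_def by (rule Fp_dim_eqI[OF p1])
  then show ?thesis using n p1 by (simp add: iso_same_card card_Fp_space)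
qed


section \<open>Integral elements\<close>

lemma (in comm_group) generate_insertE:
  assumes "x \<in> generate G (insert s S)" "s \<in> carrier G" "S \<subseteq> carrier G"
  obtains n :: int and w where "w \<in> generate G S" "x = s [^] n \<otimes> w"
proof -
  have sub: "subgroup (generate G S) G" by (rule generate_is_subgroup[OF assms(3)])
  have closed: "w \<in> carrier G" if "w \<in> generate G S" for w
    using subgroup.mem_carrier[OF sub that] .
  have "\<exists>n::int. \<exists>w\<in>generate G S. x = s [^] n \<otimes> w"
    using assms(1)
  proof (induction rule: generate.induct)
    case one
    show ?case using generate.one[of G S] by (intro exI[of _ 0] bexI[of _ \<one>]) auto
  next
    case (incl h)
    show ?case
    proof (cases "h = s")
      case True
      then show ?thesis
        using assms(2) generate.one[of G S] by (intro exI[of _ 1] bexI[of _ \<one>]) auto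
    next
      case False
      then have "h \<in> generate G S" using incl by (intro generate.incl) simp
      then show ?thesis using closed[of h] by (intro exI[of _ 0] bexI[of _ h]) simp_all
    qed
  next
    case (inv h)
    show ?case
    proof (cases "h = s")
      case True
      then show ?thesis
        using assms(2) generate.one[of G S]
        by (intro exI[of _ "-1"] bexI[of _ \<one>]) (auto simp: int_pow_neg)
    next
      case False
      then have "inv h \<in> generate G S" using inv by (intro generate.inv) simp
      then show ?thesis using closed[of "inv h"] by (intro exI[of _ 0] bexI[of _ "inv h"]) simp_all
    qed
  next
    case (eng h k)
    then obtain m n v w where hk: "h = s [^] (m::int) \<otimes> v" "k = s [^] (n::int) \<otimes> w"
      "v \<in> generate G S" "w \<in> generate G S" by blast
    have "h \<otimes> k = s [^] (m + n) \<otimes> (v \<otimes> w)"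
      using hk closed[OF hk(3)] closed[OF hk(4)] assms(2) by (simp add: int_pow_mult m_ac)
    then show ?case using subgroup.m_closed[OF sub hk(3,4)] by blast
  qed
  then show ?thesis using that by blast
qed

text \<open>The ascending chain condition in the form suited to integrality: some term of the
  sequence lies in the group generated by its predecessors. Induction on the generators; each term
  is corrected by a power of one fixed element \<open>y0\<close> so as to lose its
  \<open>s\<close>-component.\<close>

lemma (in comm_group) generate_finite_noetherian:
  assumes "finite S" "S \<subseteq> carrier G" "\<And>k::nat. z k \<in> generate G S"
  shows "\<exists>k. z k \<in> generate G (z ` {..<k})"
  using assms
proof (induction S arbitrary: z)
  case empty
  then have "z 0 = \<one>" using generate_empty by blast
  then show ?case using generate.one by metis
next
  case (insert s S)
  have s: "s \<in> carrier G" and S: "S \<subseteq> carrier G" using insert.prems by auto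
  have zc: "z k \<in> carrier G" for k
    using insert.prems(2) generate_in_carrier[OF insert.prems(1)] by blast
  have subS: "subgroup (generate G S) G" by (rule generate_is_subgroup[OF S])
  have subz: "subgroup (generate G (z ` {..<k})) G" for k
    by (rule generate_is_subgroup) (use zc in blast)
  have Sc: "w \<in> carrier G" if "w \<in> generate G S" for w
    using that subgroup.mem_carrier[OF subS] by blast
  have yc: "y \<in> carrier G" if "y \<in> generate G (z ` {..<k})" for y k
    using that subgroup.mem_carrier[OF subz] by blast
  have mono: "y \<in> generate G (z ` {..<l})" if "y \<in> generate G (z ` {..<k})" "k \<le> l" for y k l
    using mono_generate[OF image_mono, of "{..<k}" "{..<l}" z] that by auto
  have "\<exists>n. \<exists>w. w \<in> generate G S \<and> z k = s [^] (n::int) \<otimes> w" for k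
    using insert.prems(2)[of k] s S by (rule generate_insertE) blast
  then obtain c w where w: "\<And>k. w k \<in> generate G S" and c: "\<And>k. z k = s [^] (c k :: int) \<otimes> w k"
    by metis
  text \<open>The exponents of \<open>s\<close> that occur in the group generated by the sequence form an ideal; \<open>d\<close> is
    its generator.\<close>
  define J where "J n \<longleftrightarrow> (\<exists>k. \<exists>y\<in>generate G (z ` {..<k}). \<exists>v\<in>generate G S. y = s [^] int n \<otimes> v)" for n
  have "\<exists>k0 y0. y0 \<in> generate G (z ` {..<k0}) \<and> (\<forall>k. \<exists>q::int. z k \<otimes> y0 [^] q \<in> generate G S)"
  proof (cases "\<exists>n>0. J n")
    case True
    define d where "d = (LEAST n. 0 < n \<and> J n)"
    have d: "0 < d" "J d" using LeastI_ex[OF True] by (auto simp: d_def)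
    have least: "d \<le> n" if "0 < n" "J n" for n using that by (simp add: d_def Least_le)
    obtain k0 y0 v0 where y0: "y0 \<in> generate G (z ` {..<k0})" and v0: "v0 \<in> generate G S"
      and eq0: "y0 = s [^] int d \<otimes> v0" using d(2) unfolding J_def by blast
    have "z k \<otimes> y0 [^] (- (c k div int d)) \<in> generate G S" for k
    proof -
      \<comment> \<open>Division with remainder: the corrected term has \<open>s\<close>-exponent
        \<open>c k mod int d\<close>, which again occurs in \<open>J\<close> but is smaller than
        \<open>d\<close>, so it is 0.\<close>
      let ?q = "- (c k div int d)"
      have "z k \<otimes> y0 [^] ?q = s [^] (c k + int d * ?q) \<otimes> (w k \<otimes> v0 [^] ?q)"
        using s Sc[OF w] Sc[OF v0] unfolding c[of k] eq0
        by (simp add: int_pow_distrib int_pow_mult int_pow_pow m_ac del: mult_minus_right)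
      also have "c k + int d * ?q = c k mod int d"
        by (simp add: minus_div_mult_eq_mod [symmetric] algebra_simps)
      also have "c k mod int d = int (nat (c k mod int d))" using d(1) by simp
      finally have eq: "z k \<otimes> y0 [^] ?q = s [^] int (nat (c k mod int d)) \<otimes> (w k \<otimes> v0 [^] ?q)" .
      have v: "w k \<otimes> v0 [^] ?q \<in> generate G S"
        by (intro subgroup.m_closed[OF subS] subgroup_int_pow_closed[OF subS] w v0)
      have "z k \<in> generate G (z ` {..<max k0 (Suc k)})" by (intro generate.incl) simp
      moreover have "y0 \<in> generate G (z ` {..<max k0 (Suc k)})" by (rule mono[OF y0]) simp
      ultimately have "z k \<otimes> y0 [^] ?q \<in> generate G (z ` {..<max k0 (Suc k)})"
        by (intro subgroup.m_closed[OF subz] subgroup_int_pow_closed[OF subz])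
      then have "J (nat (c k mod int d))" unfolding J_def using eq v by blast
      moreover have "nat (c k mod int d) < d" using d(1) by (simp add: nat_less_iff)
      ultimately have "nat (c k mod int d) = 0" using least by (metis not_le neq0_conv)
      then show ?thesis using eq v Sc[OF v] by simp
    qed
    then show ?thesis using y0 by blast
  next
    case False
    \<comment> \<open>Positive exponents do not occur, and a negative one would turn positive for
      the inverse. All terms already lie in the smaller group, and the unit serves as
      \<open>y0\<close>.\<close>
    have "z k \<in> generate G S" for k
    proof -
      have zk: "z k \<in> generate G (z ` {..<Suc k})" by (intro generate.incl) simp
      have "\<not> 0 < c k"
      proof
        assume "0 < c k"
        then have "J (nat (c k))" unfolding J_def using zk w[of k] c[of k] by force
        moreover have "0 < nat (c k)" using \<open>0 < c k\<close> by simp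
        ultimately show False using False by blast
      qed
      moreover have "\<not> c k < 0"
      proof
        assume neg: "c k < 0"
        have "inv (z k) = s [^] int (nat (- c k)) \<otimes> inv (w k)"
          using s Sc[OF w] neg unfolding c[of k] by (simp add: inv_mult int_pow_neg)
        then have "J (nat (- c k))"
          unfolding J_def using subgroup.m_inv_closed[OF subz zk] subgroup.m_inv_closed[OF subS w[of k]] by blast
        moreover have "0 < nat (- c k)" using neg by simp
        ultimately show False using False by blast
      qed
      ultimately have "c k = 0" by simp
      then show ?thesis using c[of k] w[of k] Sc[OF w[of k]] by simp
    qed
    then show ?thesis using generate.one zc by (intro exI[of _ 0] exI[of _ \<one>]) auto
  qed
  then obtain k0 y0 q where y0: "y0 \<in> generate G (z ` {..<k0})"
    and q: "\<And>k. z k \<otimes> y0 [^] (q k :: int) \<in> generate G S" by metis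
  \<comment> \<open>The shift by \<open>k0\<close> ensures that \<open>y0\<close> lies in the group
    generated by the terms before \<open>z (k0 + j)\<close>, so the correction can be undone
    there.\<close>
  define z' where "z' j = z (k0 + j) \<otimes> y0 [^] q (k0 + j)" for j
  obtain j where j: "z' j \<in> generate G (z' ` {..<j})"
    using insert.IH[OF S, of z'] q unfolding z'_def by blast
  have y0j: "y0 [^] n \<in> generate G (z ` {..<k0 + j})" for n :: int
    using subgroup_int_pow_closed[OF subz mono[OF y0]] by simp
  have "z' i \<in> generate G (z ` {..<k0 + j})" if "i < j" for i
    unfolding z'_def using that
    by (intro generate.eng[OF _ y0j] generate.incl) simp
  then have "generate G (z' ` {..<j}) \<subseteq> generate G (z ` {..<k0 + j})"
    by (intro generate_subgroup_incl subz) auto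
  then have "z' j \<otimes> inv (y0 [^] q (k0 + j)) \<in> generate G (z ` {..<k0 + j})"
    using j y0j subgroup.m_inv_closed[OF subz] subgroup.m_closed[OF subz] by blast
  moreover have "z' j \<otimes> inv (y0 [^] q (k0 + j)) = z (k0 + j)"
    unfolding z'_def using zc yc[OF y0] by (simp add: m_assoc)
  ultimately show ?case by metis
qed

section \<open>Integrality as an additive relation among powers\<close>

lemma (in cring) mult_generate_add:
  assumes "h \<in> generate (add_monoid R) A" "A \<subseteq> carrier R" "B \<subseteq> carrier R" "c \<in> carrier R"
    and "\<And>a. a \<in> A \<Longrightarrow> c \<otimes> a \<in> generate (add_monoid R) B"
  shows "c \<otimes> h \<in> generate (add_monoid R) B"
proof -
  have sub: "subgroup (generate (add_monoid R) B) (add_monoid R)"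
    using assms(3) by (intro add.generate_is_subgroup) simp
  have closed: "h \<in> carrier R" if "h \<in> generate (add_monoid R) A" for h
    using add.generate_in_carrier[of A h] assms(2) that by simp
  show ?thesis
    using assms(1)
  proof (induction rule: generate.induct)
    case one
    then show ?case using generate.one[of "add_monoid R" B] assms(4) by simp
  next
    case (inv h)
    then have "\<ominus> (c \<otimes> h) \<in> generate (add_monoid R) B"
      using subgroup.m_inv_closed[OF sub assms(5)] by (simp add: a_inv_def)
    then show ?case using inv assms(2,4) by (simp add: r_minus subset_iff flip: a_inv_def)
  next
    case (eng h k)
    then have "c \<otimes> h \<oplus> c \<otimes> k \<in> generate (add_monoid R) B"
      using subgroup.m_closed[OF sub] by simp
    then show ?case using eng closed assms(4) by (simp add: r_distr)
  qed (use assms(5) in blast)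
qed

text \<open>A monic integral equation with the polynomial removed: some power is an integer
  combination of lower ones. In this form integrality passes along homomorphisms and to subrings,
  and the Noetherian property applies directly.\<close>

definition (in ring) integral :: "'a \<Rightarrow> bool" where
  "integral x \<longleftrightarrow> (\<exists>n. x [^] n \<in> generate (add_monoid R) ((\<lambda>i. x [^] i) ` {..<n::nat}))"

lemma (in cring) eval_in_generate_powers:
  assumes "x \<in> carrier R" "set cs \<subseteq> range (\<lambda>n::int. [n] \<cdot> \<one>)"
  shows "eval cs x \<in> generate (add_monoid R) ((\<lambda>i. x [^] i) ` {..<length cs})"
  using assms(2)
proof (induction cs)
  case Nil
  then show ?case using generate.one[of "add_monoid R" "{}"] by simp
next
  case (Cons a cs)
  let ?G = "generate (add_monoid R) ((\<lambda>i. x [^] i) ` {..<length (a # cs)})"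
  have sub: "subgroup ?G (add_monoid R)"
    using assms(1) by (intro add.generate_is_subgroup) auto
  obtain n :: int where n: "a = [n] \<cdot> \<one>" using Cons.prems by auto
  have "x [^] length cs \<in> ?G" by (intro generate.incl) auto
  then have "[n] \<cdot> (x [^] length cs) \<in> ?G"
    using add.subgroup_int_pow_closed[OF sub] by (simp add: add_pow_def)
  moreover have "a \<otimes> x [^] length cs = [n] \<cdot> (x [^] length cs)"
    unfolding n using assms(1) by (simp add: add_pow_ldistr_int)
  moreover have "eval cs x \<in> ?G"
    using Cons add.mono_generate[OF image_mono, of "{..<length cs}" "{..<length (a # cs)}" "\<lambda>i. x [^] i"]
    by auto
  ultimately show ?case using subgroup.m_closed[OF sub] by simp
qed

lemma (in cring) generate_powers_imp_eval:
  assumes "x \<in> carrier R" "y \<in> generate (add_monoid R) ((\<lambda>i. x [^] i) ` {..<n::nat})"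
  shows "\<exists>cs. length cs = n \<and> set cs \<subseteq> range (\<lambda>n::int. [n] \<cdot> \<one>) \<and> eval cs x = y"
  using assms(2)
proof (induction n arbitrary: y)
  case 0
  then show ?case using add.generate_empty by simp
next
  case (Suc n)
  have "y \<in> generate (add_monoid R) (insert (x [^] n) ((\<lambda>i. x [^] i) ` {..<n}))"
    using Suc.prems by (simp add: lessThan_Suc)
  then obtain k :: int and w where w: "w \<in> generate (add_monoid R) ((\<lambda>i. x [^] i) ` {..<n})"
    and y: "y = [k] \<cdot> (x [^] n) \<oplus> w"
    by (rule add.generate_insertE) (use assms(1) in auto)
  obtain cs where cs: "length cs = n" "set cs \<subseteq> range (\<lambda>n::int. [n] \<cdot> \<one>)" "eval cs x = w"
    using Suc.IH[OF w] by blast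
  have "eval (([k] \<cdot> \<one>) # cs) x = y"
    using cs y assms(1) by (simp add: add_pow_ldistr_int)
  then show ?case using cs by (intro exI[of _ "([k] \<cdot> \<one>) # cs"]) auto
qed

lemma (in domain) integral_over_Z_iff:
  assumes x: "x \<in> carrier R"
  shows "integral_over_Z R x \<longleftrightarrow> integral x"
proof
  assume "integral_over_Z R x"
  then obtain q where q: "polynomial\<^bsub>R\<^esub> (range (\<lambda>n::int. [n] \<cdot> \<one>)) q" "q \<noteq> []" "hd q = \<one>" "eval q x = \<zero>"
    unfolding integral_over_Z_def by blast
  then obtain cs where cs: "q = \<one> # cs" by (cases q) auto
  let ?G = "generate (add_monoid R) ((\<lambda>i. x [^] i) ` {..<length cs})"
  have "set cs \<subseteq> range (\<lambda>n::int. [n] \<cdot> \<one>)" using q(1) cs by (auto simp: polynomial_def)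
  then have ev: "eval cs x \<in> ?G" by (rule eval_in_generate_powers[OF x])
  have sub: "subgroup ?G (add_monoid R)"
    using x by (intro add.generate_is_subgroup) auto
  have evc: "eval cs x \<in> carrier R" using subgroup.mem_carrier[OF sub ev] by simp
  have "x [^] length cs \<oplus> eval cs x = \<zero>" using q(4) cs x by simp
  then have "x [^] length cs = \<ominus> eval cs x" using x evc by (simp add: minus_equality)
  then show "integral x"
    unfolding integral_def using subgroup.m_inv_closed[OF sub ev] by (metis a_inv_def)
next
  assume "integral x"
  then obtain n where n: "x [^] n \<in> generate (add_monoid R) ((\<lambda>i. x [^] i) ` {..<n::nat})"
    unfolding integral_def by blast
  then have "\<ominus> (x [^] n) \<in> generate (add_monoid R) ((\<lambda>i. x [^] i) ` {..<n})"
    using x add.generate_m_inv_closed[OF _ n] by (auto simp: a_inv_def)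
  then obtain cs where cs: "length cs = n" "set cs \<subseteq> range (\<lambda>n::int. [n] \<cdot> \<one>)" "eval cs x = \<ominus> (x [^] n)"
    using generate_powers_imp_eval[OF x] by blast
  have "\<one> \<in> range (\<lambda>n::int. [n] \<cdot> \<one>)"
    using add.int_pow_1[OF one_closed] by (metis rangeI)
  then have "polynomial\<^bsub>R\<^esub> (range (\<lambda>n::int. [n] \<cdot> \<one>)) (\<one> # cs)"
    using cs(2) by (auto simp: polynomial_def)
  moreover have "eval (\<one> # cs) x = \<zero>" using cs x by (simp add: r_neg)
  ultimately show "integral_over_Z R x"
    unfolding integral_over_Z_def by (intro exI[of _ "\<one> # cs"]) auto
qed

lemma (in ring) integral_one: "integral \<one>"
  unfolding integral_def by (intro exI[of _ 1]) (auto intro: generate.incl)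

text \<open>The additive group generated by the finitely many products x^i y^j with i < n and j < m
  is stable under multiplication by x and by y, so it contains all powers of xy. By the Noetherian
  property some power of xy is a combination of earlier ones.\<close>

lemma (in domain) integral_mult:
  assumes x: "x \<in> carrier R" "integral x" and y: "y \<in> carrier R" "integral y"
  shows "integral (x \<otimes> y)"
proof -
  obtain n where n: "x [^] n \<in> generate (add_monoid R) ((\<lambda>i. x [^] i) ` {..<n::nat})"
    using x(2) unfolding integral_def by blast
  obtain m where m: "y [^] m \<in> generate (add_monoid R) ((\<lambda>i. y [^] i) ` {..<m::nat})"
    using y(2) unfolding integral_def by blast
  \<comment> \<open>With exponent 0 the unit would lie in the trivial group. Positivity puts 1 = x^0
    y^0 among the generators.\<close>
  have pos: "0 < n" "0 < m"
    using n m add.generate_empty by (auto intro!: Nat.gr0I)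
  define S where "S = (\<lambda>(i, j). x [^] i \<otimes> y [^] j) ` ({..<n} \<times> {..<m})"
  let ?G = "generate (add_monoid R) S"
  have S: "finite S" "S \<subseteq> carrier R" using x y by (auto simp: S_def)
  have inS: "x [^] i \<otimes> y [^] j \<in> ?G" if "i < n" "j < m" for i j
    using that by (intro generate.incl) (auto simp: S_def)
  have mult_x: "x \<otimes> g \<in> ?G" if "g \<in> ?G" for g
  proof (rule mult_generate_add[OF that S(2) S(2) x(1)])
    fix a assume "a \<in> S"
    then obtain i j where a: "a = x [^] i \<otimes> y [^] j" "i < n" "j < m" by (auto simp: S_def)
    have eq: "x \<otimes> a = x [^] Suc i \<otimes> y [^] j" using a x y by (simp add: m_ac)
    show "x \<otimes> a \<in> ?G"
    proof (cases "Suc i < n")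
      case True
      then show ?thesis unfolding eq using inS a by blast
    next
      case False
      then have "Suc i = n" using a by simp
      \<comment> \<open>The exponent of x has left its range; x^n is replaced by lower powers, whose
        products with y^j are generators.\<close>
      moreover have "y [^] j \<otimes> x [^] n \<in> ?G"
        by (rule mult_generate_add[OF n _ S(2)]) (use x y inS a in \<open>auto simp: m_comm\<close>)
      ultimately show ?thesis unfolding eq using x y by (simp add: m_comm)
    qed
  qed
  have mult_y: "y \<otimes> g \<in> ?G" if "g \<in> ?G" for g
  proof (rule mult_generate_add[OF that S(2) S(2) y(1)])
    fix a assume "a \<in> S"
    then obtain i j where a: "a = x [^] i \<otimes> y [^] j" "i < n" "j < m" by (auto simp: S_def)
    have eq: "y \<otimes> a = x [^] i \<otimes> y [^] Suc j" using a x y by (simp add: m_ac)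
    show "y \<otimes> a \<in> ?G"
    proof (cases "Suc j < m")
      case True
      then show ?thesis unfolding eq using inS a by blast
    next
      case False
      then have "Suc j = m" using a by simp
      moreover have "x [^] i \<otimes> y [^] m \<in> ?G"
        by (rule mult_generate_add[OF m _ S(2)]) (use x y inS a in auto)
      ultimately show ?thesis unfolding eq by simp
    qed
  qed
  have powers: "(x \<otimes> y) [^] k \<in> ?G" for k :: nat
  proof (induction k)
    case 0
    then show ?case using inS[of 0 0] pos by simp
  next
    case (Suc k)
    have "(x \<otimes> y) [^] Suc k = x \<otimes> (y \<otimes> (x \<otimes> y) [^] k)" using x y by (simp add: m_ac)
    then show ?case using mult_x mult_y Suc by simp
  qed
  show ?thesis
    unfolding integral_def using add.generate_finite_noetherian[of S "\<lambda>k. (x \<otimes> y) [^] k"] S powers by simp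
qed

lemma (in domain) integral_hom:
  assumes h: "h \<in> ring_hom R R" and x: "x \<in> carrier R" "integral x"
  shows "integral (h x)"
proof -
  interpret h: ring_hom_ring R R h using h by (intro ring_hom_ringI2 ring_axioms)
  interpret add: group_hom "add_monoid R" "add_monoid R" h by (rule h.a_group_hom)
  obtain n where n: "x [^] n \<in> generate (add_monoid R) ((\<lambda>i. x [^] i) ` {..<n::nat})"
    using x(2) unfolding integral_def by blast
  have "h (x [^] n) \<in> generate (add_monoid R) (h ` (\<lambda>i. x [^] i) ` {..<n})"
    using add.generate_img[of "(\<lambda>i. x [^] i) ` {..<n}"] n x by auto
  moreover have "h ` (\<lambda>i. x [^] i) ` {..<n} = (\<lambda>i. h x [^] i) ` {..<n}"
    using x by (auto simp: image_image h.hom_nat_pow)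
  ultimately show ?thesis
    unfolding integral_def using x by (metis h.hom_nat_pow)
qed

text \<open>The group generated by the powers of x is the same in the subring as in the ring, so the
  integers of a subfield are the integers of the field that lie in it.\<close>

lemma (in ring) integral_consistent:
  assumes K: "subring K R" and x: "x \<in> K"
  shows "ring.integral (R\<lparr>carrier := K\<rparr>) x \<longleftrightarrow> integral x"
proof -
  interpret K: ring "R\<lparr>carrier := K\<rparr>" by (rule subring_is_ring[OF K])
  have pow: "x [^]\<^bsub>R\<lparr>carrier := K\<rparr>\<^esub> i = x [^] i" for i :: nat
    by (rule nat_pow_consistent[symmetric])
  have "x [^] i \<in> K" for i :: nat
    using K.nat_pow_closed[of x i] x by (simp add: pow)
  moreover have "subgroup K (add_monoid R)" using K subring.axioms(1) by blast
  ultimately have "generate (add_monoid R\<lparr>carrier := K\<rparr>) ((\<lambda>i. x [^] i) ` {..<n}) =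
      generate (add_monoid R) ((\<lambda>i. x [^] i) ` {..<n})" for n :: nat
    by (intro add.generate_consistent) auto
  then show ?thesis
    unfolding K.integral_def integral_def pow by simp
qed


section \<open>Units modulo p-th powers\<close>

text \<open>Cosets of the kernel correspond to values of \<open>h\<close>; the rest is Lagrange's
  theorem.\<close>

lemma (in group_hom) card_image_kernel:
  "card (h ` carrier G) * card (kernel G H h) = card (carrier G)"
proof -
  have "the_elem (h ` (kernel G H h #> x)) = h x" if x: "x \<in> carrier G" for x
  proof -
    have "x \<in> kernel G H h #> x" by (rule G.rcos_self[OF x subgroup_kernel])
    moreover have "h y = h x" if "y \<in> kernel G H h #> x" for y
      using that x by (auto simp: r_coset_def kernel_def)
    ultimately have "h ` (kernel G H h #> x) = {h x}" by blast
    then show ?thesis by simp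
  qed
  then have "(\<lambda>C. the_elem (h ` C)) ` carrier (G Mod kernel G H h) = h ` carrier G"
    unfolding carrier_FactGroup image_image by (rule image_cong[OF refl])
  then have "bij_betw (\<lambda>C. the_elem (h ` C)) (carrier (G Mod kernel G H h)) (h ` carrier G)"
    using FactGroup_inj_on by (simp add: bij_betw_def)
  then have "card (rcosets kernel G H h) = card (h ` carrier G)"
    by (simp add: bij_betw_same_card FactGroup_def)
  then show ?thesis
    using G.lagrange[OF subgroup_kernel] by (simp add: Coset.order_def)
qed

section \<open>Quotients by p-th powers\<close>

context comm_group
begin

lemma subgroup_imp_comm_group:
  assumes "subgroup H G"
  shows "comm_group (G\<lparr>carrier := H\<rparr>)"
proof (rule group.group_comm_groupI[OF subgroup_imp_group[OF assms]])
  fix x y assume "x \<in> carrier (G\<lparr>carrier := H\<rparr>)" "y \<in> carrier (G\<lparr>carrier := H\<rparr>)"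
  then show "x \<otimes>\<^bsub>G\<lparr>carrier := H\<rparr>\<^esub> y = y \<otimes>\<^bsub>G\<lparr>carrier := H\<rparr>\<^esub> x"
    using m_comm[OF subgroup.mem_carrier[OF assms] subgroup.mem_carrier[OF assms]] by simp
qed

lemma subgroup_powers: "subgroup (powers p G) G"
proof (rule subgroupI)
  show "powers p G \<subseteq> carrier G" by (auto simp: powers_def)
  show "powers p G \<noteq> {}" by (auto simp: powers_def)
  fix a b assume "a \<in> powers p G" "b \<in> powers p G"
  then obtain x y where xy: "x \<in> carrier G" "a = x [^] p" "y \<in> carrier G" "b = y [^] p"
    by (auto simp: powers_def)
  have "inv a = inv x [^] p" "a \<otimes> b = (x \<otimes> y) [^] p"
    using xy by (simp_all add: nat_pow_inv nat_pow_distrib)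
  then show "inv a \<in> powers p G" "a \<otimes> b \<in> powers p G"
    using xy by (auto simp: powers_def)
qed

text \<open>\<open>H\<close> may exceed the group of p-th powers, as it can for the quotient of
  \<open>fixed_points \<inter> P\<close> by \<open>Q\<close>.\<close>

lemma elementary_abelian_quotient:
  assumes "Factorial_Ring.prime p" "subgroup H G" "powers p G \<subseteq> H"
  shows "elementary_abelian (G Mod H) p"
proof -
  interpret H: normal H G using assms(2) by (simp add: normal_iff_subgroup)
  show ?thesis
  proof (intro elementary_abelian.intro elementary_abelian_axioms.intro abelian_FactGroup assms(1,2))
    fix C assume "C \<in> carrier (G Mod H)"
    then obtain x where x: "x \<in> carrier G" "C = H #> x" by (auto simp: carrier_FactGroup)
    then have "C [^]\<^bsub>G Mod H\<^esub> p = H #> (x [^] p)" by (simp add: H.FactGroup_pow)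
    moreover have "x [^] p \<in> H" using x assms(3) by (auto simp: powers_def)
    ultimately show "C [^]\<^bsub>G Mod H\<^esub> p = \<one>\<^bsub>G Mod H\<^esub>"
      using x assms(2) by (simp add: coset_join2)
  qed
qed

end

text \<open>The abstract setting of the rank computation. In the application \<open>A\<close> is the
  unit group of F, \<open>fixed_points\<close> is that of K, and \<open>P\<close> and
  \<open>Q\<close> are their groups of p-th powers.\<close>

locale p_group_action = comm_group A + \<Gamma>: group \<Gamma>
  for A :: "'a monoid" (structure) and \<Gamma> :: "('g, 'e) monoid_scheme" +
  fixes p :: nat and act :: "'g \<Rightarrow> 'a \<Rightarrow> 'a"
  assumes prime_p: "Factorial_Ring.prime p"
    and act_hom: "\<sigma> \<in> carrier \<Gamma> \<Longrightarrow> act \<sigma> \<in> hom A A"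
    and act_one: "x \<in> carrier A \<Longrightarrow> act \<one>\<^bsub>\<Gamma>\<^esub> x = x"
    and act_mult: "\<sigma> \<in> carrier \<Gamma> \<Longrightarrow> \<tau> \<in> carrier \<Gamma> \<Longrightarrow> x \<in> carrier A \<Longrightarrow>
      act (\<sigma> \<otimes>\<^bsub>\<Gamma>\<^esub> \<tau>) x = act \<sigma> (act \<tau> x)"
    and order_power: "\<exists>n. Coset.order \<Gamma> = p ^ n"
begin

abbreviation P where "P \<equiv> powers p A"

definition fixed_points :: "'a set" where
  "fixed_points = {x \<in> carrier A. \<forall>\<sigma>\<in>carrier \<Gamma>. act \<sigma> x = x}"

abbreviation B where "B \<equiv> A\<lparr>carrier := fixed_points\<rparr>"

abbreviation Q where "Q \<equiv> powers p B"

definition element_norm :: "'a \<Rightarrow> 'a" where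
  "element_norm x = (\<Otimes>\<sigma>\<in>carrier \<Gamma>. act \<sigma> x)"

lemma finite_\<Gamma> [simp]: "finite (carrier \<Gamma>)"
  using order_power prime_gt_0_nat[OF prime_p] by (metis \<Gamma>.order_gt_0_iff_finite zero_less_power)

lemma act_closed [simp]: "\<sigma> \<in> carrier \<Gamma> \<Longrightarrow> x \<in> carrier A \<Longrightarrow> act \<sigma> x \<in> carrier A"
  using act_hom hom_in_carrier by metis

lemma act_group_hom: "\<sigma> \<in> carrier \<Gamma> \<Longrightarrow> group_hom A A (act \<sigma>)"
  using act_hom by unfold_locales auto

lemma act_nat_pow: "\<sigma> \<in> carrier \<Gamma> \<Longrightarrow> x \<in> carrier A \<Longrightarrow> act \<sigma> (x [^] (n::nat)) = act \<sigma> x [^] n"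
  using group_hom.hom_nat_pow[OF act_group_hom] .

lemma subgroup_P: "subgroup P A"
  by (rule subgroup_powers)

lemma normal_P: "P \<lhd> A"
  using subgroup_P by (simp add: normal_iff_subgroup)

lemma subgroup_fixed_points: "subgroup fixed_points A"
proof (rule subgroupI)
  show "fixed_points \<subseteq> carrier A" by (auto simp: fixed_points_def)
  have "\<one> \<in> fixed_points"
    using group_hom.hom_one[OF act_group_hom] by (simp add: fixed_points_def)
  then show "fixed_points \<noteq> {}" by blast
  fix a b assume ab: "a \<in> fixed_points" "b \<in> fixed_points"
  show "inv a \<in> fixed_points"
    using ab group_hom.hom_inv[OF act_group_hom] by (simp add: fixed_points_def)
  show "a \<otimes> b \<in> fixed_points"
    using ab hom_mult[OF act_hom] by (simp add: fixed_points_def)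
qed

lemma comm_group_B: "comm_group B"
  by (rule subgroup_imp_comm_group[OF subgroup_fixed_points])

lemma pow_B: "x [^]\<^bsub>B\<^esub> (n::nat) = x [^] n"
  by (rule nat_pow_consistent[symmetric])

lemma Q_subset: "Q \<subseteq> fixed_points \<inter> P"
proof
  fix x assume "x \<in> Q"
  then obtain y where y: "y \<in> fixed_points" "x = y [^] p" by (auto simp: powers_def pow_B)
  then have "y \<in> carrier A" by (simp add: fixed_points_def)
  then have "x \<in> fixed_points" "x \<in> P"
    using y by (auto simp: fixed_points_def act_nat_pow powers_def)
  then show "x \<in> fixed_points \<inter> P" by blast
qed

text \<open>The action maps p-th powers to p-th powers; the inverse group element gives the reverse
  inclusion.\<close>

lemma act_image_coset:
  assumes \<sigma>: "\<sigma> \<in> carrier \<Gamma>" and x: "x \<in> carrier A"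
  shows "act \<sigma> ` (P #> x) = P #> act \<sigma> x"
proof (intro equalityI subsetI)
  fix y assume "y \<in> act \<sigma> ` (P #> x)"
  then obtain z where z: "z \<in> carrier A" "y = act \<sigma> (z [^] p \<otimes> x)"
    by (auto simp: r_coset_def powers_def)
  then have "y = act \<sigma> z [^] p \<otimes> act \<sigma> x"
    using \<sigma> x by (simp add: hom_mult[OF act_hom] act_nat_pow)
  then show "y \<in> P #> act \<sigma> x"
    unfolding r_coset_def powers_def using act_closed[OF \<sigma> z(1)] by blast
next
  fix y assume "y \<in> P #> act \<sigma> x"
  then obtain z where z: "z \<in> carrier A" "y = z [^] p \<otimes> act \<sigma> x"
    by (auto simp: r_coset_def powers_def)
  let ?w = "act (inv\<^bsub>\<Gamma>\<^esub> \<sigma>) z"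
  have "act \<sigma> ?w = z" using act_mult[of \<sigma> "inv\<^bsub>\<Gamma>\<^esub> \<sigma>" z] act_one \<sigma> z by simp
  then have "y = act \<sigma> (?w [^] p \<otimes> x)"
    using \<sigma> x z by (simp add: hom_mult[OF act_hom] act_nat_pow)
  moreover have "?w [^] p \<otimes> x \<in> P #> x"
    unfolding r_coset_def powers_def using act_closed[OF \<Gamma>.inv_closed[OF \<sigma>] z(1)] by blast
  ultimately show "y \<in> act \<sigma> ` (P #> x)" by blast
qed

lemma coset_mult: "x \<in> carrier A \<Longrightarrow> y \<in> carrier A \<Longrightarrow> (P #> x) <#> (P #> y) = P #> (x \<otimes> y)"
  by (rule normal.rcos_sum[OF normal_P])

lemma modular_rep_quotient: "modular_rep (A Mod P) p \<Gamma> (\<lambda>\<sigma> C. act \<sigma> ` C)"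
proof (intro modular_rep.intro modular_rep_axioms.intro \<Gamma>.is_group order_power)
  show "elementary_abelian (A Mod P) p"
    using elementary_abelian_quotient[OF prime_p subgroup_P] by simp
next
  fix \<sigma> assume \<sigma>: "\<sigma> \<in> carrier \<Gamma>"
  show "(`) (act \<sigma>) \<in> hom (A Mod P) (A Mod P)"
  proof (rule homI)
    fix C D assume "C \<in> carrier (A Mod P)" "D \<in> carrier (A Mod P)"
    then obtain x y where xy: "x \<in> carrier A" "C = P #> x" "y \<in> carrier A" "D = P #> y"
      by (auto simp: carrier_FactGroup)
    then show "act \<sigma> ` (C \<otimes>\<^bsub>A Mod P\<^esub> D) = act \<sigma> ` C \<otimes>\<^bsub>A Mod P\<^esub> act \<sigma> ` D"
      using \<sigma> by (simp add: coset_mult act_image_coset hom_mult[OF act_hom])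
  qed (use \<sigma> in \<open>auto simp: carrier_FactGroup act_image_coset\<close>)
next
  fix C assume "C \<in> carrier (A Mod P)"
  then obtain x where "x \<in> carrier A" "C = P #> x" by (auto simp: carrier_FactGroup)
  then show "act \<one>\<^bsub>\<Gamma>\<^esub> ` C = C" by (simp add: act_image_coset act_one)
next
  fix \<sigma> \<tau> C assume \<sigma>\<tau>: "\<sigma> \<in> carrier \<Gamma>" "\<tau> \<in> carrier \<Gamma>" and "C \<in> carrier (A Mod P)"
  then obtain x where "x \<in> carrier A" "C = P #> x" by (auto simp: carrier_FactGroup)
  then show "act (\<sigma> \<otimes>\<^bsub>\<Gamma>\<^esub> \<tau>) ` C = act \<sigma> ` act \<tau> ` C"
    using \<sigma>\<tau> by (simp add: act_image_coset act_mult)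
qed

end

section \<open>The norm on elements and on classes\<close>

sublocale p_group_action \<subseteq> V: modular_rep "A Mod P" p \<Gamma> "\<lambda>\<sigma> C. act \<sigma> ` C"
  by (rule modular_rep_quotient)

context p_group_action
begin

lemma element_norm_hom: "element_norm \<in> hom A A"
proof (rule homI)
  fix x y assume "x \<in> carrier A" "y \<in> carrier A"
  then show "element_norm (x \<otimes> y) = element_norm x \<otimes> element_norm y"
    unfolding element_norm_def
    by (simp add: hom_mult[OF act_hom] flip: finprod_multf cong: finprod_cong)
qed (auto simp: element_norm_def intro: finprod_closed)

lemma element_norm_closed [simp]: "x \<in> carrier A \<Longrightarrow> element_norm x \<in> carrier A"
  using hom_in_carrier[OF element_norm_hom] .

lemma element_norm_fixed:
  assumes x: "x \<in> carrier A"
  shows "element_norm x \<in> fixed_points"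
proof -
  have "act \<tau> (element_norm x) = element_norm x" if \<tau>: "\<tau> \<in> carrier \<Gamma>" for \<tau>
  proof -
    have surj: "(\<lambda>\<sigma>. \<tau> \<otimes>\<^bsub>\<Gamma>\<^esub> \<sigma>) ` carrier \<Gamma> = carrier \<Gamma>" by (rule \<Gamma>.surj_const_mult[OF \<tau>])
    have "act \<tau> (element_norm x) = (\<Otimes>\<sigma>\<in>carrier \<Gamma>. act \<tau> (act \<sigma> x))"
      unfolding element_norm_def
      by (rule hom_finprod)
        (use x \<tau> act_hom group_hom.hom_one[OF act_group_hom] in \<open>auto simp: comm_monoid_axioms\<close>)
    also have "\<dots> = (\<Otimes>\<sigma>\<in>carrier \<Gamma>. act (\<tau> \<otimes>\<^bsub>\<Gamma>\<^esub> \<sigma>) x)"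
      using x \<tau> by (intro finprod_cong') (auto simp: act_mult)
    also have "\<dots> = (\<Otimes>\<sigma>\<in>(\<lambda>\<sigma>. \<tau> \<otimes>\<^bsub>\<Gamma>\<^esub> \<sigma>) ` carrier \<Gamma>. act \<sigma> x)"
      using x \<tau> by (intro finprod_reindex[symmetric]) (auto simp: inj_on_def)
    also have "\<dots> = element_norm x" by (simp add: surj element_norm_def)
    finally show ?thesis .
  qed
  then show ?thesis using x by (simp add: fixed_points_def)
qed

text \<open>Passing to classes is a homomorphism and commutes with the action, so it carries the
  product of conjugates to the norm of the class.\<close>

lemma norm_coset:
  assumes x: "x \<in> carrier A"
  shows "V.norm (P #> x) = P #> element_norm x"
proof -
  interpret cls: group_hom A "A Mod P" "\<lambda>a. P #> a"
    using normal.r_coset_hom_Mod[OF normal_P] by unfold_locales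
  have "P #> element_norm x = finprod (A Mod P) (\<lambda>\<sigma>. P #> act \<sigma> x) (carrier \<Gamma>)"
    unfolding element_norm_def
    by (rule hom_finprod)
      (use x cls.homh cls.hom_one comm_monoid_axioms V.comm_monoid_axioms in auto)
  also have "\<dots> = V.norm (P #> x)"
    unfolding V.norm_def using x
    by (intro V.finprod_cong') (auto simp: act_image_coset carrier_FactGroup)
  finally show ?thesis by simp
qed

text \<open>A Kummer argument: \<open>f u\<close> is the cocycle attached to a chosen p-th root
  \<open>r u\<close> of u. If \<open>f u\<close> and \<open>f v\<close> agree, then
  \<open>r v / r u\<close> is fixed, so v / u is the p-th power of a fixed point. There are finitely
  many functions from \<Gamma> to the p-torsion.\<close>

lemma finite_unit_kernel:
  assumes fin: "finite {x \<in> carrier A. x [^] p = \<one>}"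
  shows "finite ((\<lambda>u. Q #> u) ` (fixed_points \<inter> P))"
proof -
  interpret B: comm_group B by (rule comm_group_B)
  have "\<exists>x. x \<in> carrier A \<and> x [^] p = u" if "u \<in> P" for u
    using that by (auto simp: powers_def)
  then obtain r where r: "\<And>u. u \<in> P \<Longrightarrow> r u \<in> carrier A" "\<And>u. u \<in> P \<Longrightarrow> r u [^] p = u"
    by metis
  define f where "f u = (\<lambda>\<sigma>\<in>carrier \<Gamma>. act \<sigma> (r u) \<otimes> inv (r u))" for u
  have "f u \<in> carrier \<Gamma> \<rightarrow>\<^sub>E {x \<in> carrier A. x [^] p = \<one>}" if u: "u \<in> fixed_points \<inter> P" for u
  proof -
    have "(act \<sigma> (r u) \<otimes> inv (r u)) [^] p = \<one>" if "\<sigma> \<in> carrier \<Gamma>" for \<sigma>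
    proof -
      have "act \<sigma> (r u) [^] p = u"
        using act_nat_pow[OF that, of "r u" p] r u that by (simp add: fixed_points_def)
      then have "(act \<sigma> (r u) \<otimes> inv (r u)) [^] p = u \<otimes> inv u"
        using r u that by (simp add: nat_pow_distrib nat_pow_inv)
      also have "\<dots> = \<one>" using u by (simp add: fixed_points_def)
      finally show ?thesis .
    qed
    then show ?thesis using r u by (auto simp: f_def)
  qed
  then have fin_f: "finite (f ` (fixed_points \<inter> P))"
    using finite_PiE[OF finite_\<Gamma>, of "\<lambda>_. {x \<in> carrier A. x [^] p = \<one>}"] fin
    by (blast intro: finite_subset)
  have inj: "Q #> u = Q #> v"
    if u: "u \<in> fixed_points \<inter> P" and v: "v \<in> fixed_points \<inter> P" and eq: "f u = f v" for u v
  proof -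
    let ?y = "r v \<otimes> inv (r u)"
    have ru: "r u \<in> carrier A" "r v \<in> carrier A" "r u [^] p = u" "r v [^] p = v" using u v r by auto
    have "act \<sigma> ?y = ?y" if \<sigma>: "\<sigma> \<in> carrier \<Gamma>" for \<sigma>
    proof -
      have "act \<sigma> (r u) \<otimes> inv (r u) = act \<sigma> (r v) \<otimes> inv (r v)"
        using fun_cong[OF eq, of \<sigma>] \<sigma> by (simp add: f_def)
      then have "act \<sigma> (r v) = act \<sigma> (r u) \<otimes> inv (r u) \<otimes> r v"
        using ru \<sigma> by (metis inv_solve_right act_closed inv_closed m_closed)
      then have "act \<sigma> (r v) \<otimes> inv (act \<sigma> (r u)) = (act \<sigma> (r u) \<otimes> inv (act \<sigma> (r u))) \<otimes> ?y"
        using ru \<sigma> by (simp add: m_ac del: r_inv l_inv)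
      then show ?thesis
        using ru \<sigma> by (simp add: hom_mult[OF act_hom] group_hom.hom_inv[OF act_group_hom])
    qed
    then have "?y \<in> fixed_points" using ru by (simp add: fixed_points_def)
    then have "?y [^] p \<in> Q" by (auto simp: powers_def pow_B)
    moreover have "v = ?y [^] p \<otimes> u"
      using ru by (simp add: nat_pow_distrib nat_pow_inv m_assoc) (metis inv_closed l_inv m_assoc nat_pow_closed r_one)
    ultimately have "v \<in> Q #>\<^bsub>B\<^esub> u" by (auto simp: r_coset_def)
    then have "Q #>\<^bsub>B\<^esub> u = Q #>\<^bsub>B\<^esub> v"
      using u by (intro B.repr_independence B.subgroup_powers) auto
    then show ?thesis by simp
  qed
  show ?thesis
  proof (rule finite_surj[OF fin_f])
    \<comment> \<open>The class of u depends only on the value \<open>f u\<close>, so one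
      representative of each value reaches all classes.\<close>
    let ?g = "\<lambda>y. Q #> inv_into (fixed_points \<inter> P) f y"
    show "(\<lambda>u. Q #> u) ` (fixed_points \<inter> P) \<subseteq> ?g ` f ` (fixed_points \<inter> P)"
    proof (rule image_subsetI)
      fix u assume u: "u \<in> fixed_points \<inter> P"
      then have fu: "f u \<in> f ` (fixed_points \<inter> P)" by blast
      have "Q #> u = ?g (f u)"
        by (rule inj[OF u inv_into_into[OF fu] f_inv_into_f[OF fu, symmetric]])
      then show "Q #> u \<in> ?g ` f ` (fixed_points \<inter> P)" using fu by blast
    qed
  qed
qed

text \<open>On the image \<open>?T\<close> of the induced norm, of size p^t, the natural map
  \<open>i\<close> from \<open>B Mod Q\<close> to \<open>A Mod P\<close> has the norms of
  \<open>A Mod P\<close> as its image, of size p^r. Its kernel \<open>?K\<close> lies in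
  \<open>U\<close>, and p^r * |?K| = p^t gives the three claims.\<close>

theorem norm_image_rank:
  assumes fin: "finite {x \<in> carrier A. x [^] p = \<one>}"
    and T: "card ((\<lambda>x. Q #> element_norm x) ` carrier A) = p ^ t"
  defines "r \<equiv> max_free_rank (Fp_group_algebra p \<Gamma>) V.rep_module"
    and "U \<equiv> B\<lparr>carrier := fixed_points \<inter> P\<rparr> Mod Q"
  shows "r \<le> t" "t \<le> r + d_Fp p U" "fixed_points \<inter> P = Q \<Longrightarrow> t = r"
proof -
  have p1: "1 < p" by (rule prime_gt_1_nat[OF prime_p])
  interpret B: comm_group B by (rule comm_group_B)
  have QB: "subgroup Q B" by (rule B.subgroup_powers)
  interpret Q: normal Q B using QB by (simp add: B.normal_iff_subgroup)
  let ?W = "B Mod Q" and ?T = "(\<lambda>x. Q #> element_norm x) ` carrier A"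
  interpret W: comm_group ?W by (rule B.abelian_FactGroup[OF QB])
  \<comment> \<open>A product set avoids choosing representatives; since P absorbs Q, the coset of b
    modulo Q goes to the coset of b modulo P.\<close>
  define i where "i D = P <#> D" for D
  have i_coset: "i (Q #> b) = P #> b" if b: "b \<in> fixed_points" for b
  proof -
    have "b \<in> carrier A" "Q \<subseteq> carrier A" using b Q_subset by (auto simp: fixed_points_def)
    moreover have "P <#> Q = P"
    proof
      show "P <#> Q \<subseteq> P"
        using subgroup.m_closed[OF subgroup_P] Q_subset by (auto simp: set_mult_def)
      have "\<one> \<in> Q" using subgroup.one_closed[OF QB] by simp
      then have "x = x \<otimes> \<one> \<and> \<one> \<in> Q" if "x \<in> P" for x
        using subgroup.mem_carrier[OF subgroup_P that] by simp
      then show "P \<subseteq> P <#> Q" unfolding set_mult_def by blast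
    qed
    ultimately show ?thesis
      unfolding i_def using setmult_rcos_assoc[of P Q b] subgroup.subset[OF subgroup_P] by simp
  qed
  have W: "carrier ?W = (\<lambda>b. Q #> b) ` fixed_points" by (simp add: carrier_FactGroup)
  have fixed_carrier: "b \<in> carrier A" if "b \<in> fixed_points" for b
    using that by (simp add: fixed_points_def)
  have norm_hom: "(\<lambda>x. Q #> element_norm x) \<in> hom A ?W"
  proof (rule homI)
    fix x y assume xy: "x \<in> carrier A" "y \<in> carrier A"
    have "(Q #>\<^bsub>B\<^esub> element_norm x) <#>\<^bsub>B\<^esub> (Q #>\<^bsub>B\<^esub> element_norm y) =
        Q #>\<^bsub>B\<^esub> (element_norm x \<otimes>\<^bsub>B\<^esub> element_norm y)"
      using xy by (intro Q.rcos_sum) (auto simp: element_norm_fixed)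
    then show "Q #> element_norm (x \<otimes> y) = (Q #> element_norm x) \<otimes>\<^bsub>?W\<^esub> (Q #> element_norm y)"
      using xy by (simp add: hom_mult[OF element_norm_hom])
  qed (auto simp: W element_norm_fixed)
  then have subT: "subgroup ?T ?W"
    using group_hom.img_is_subgroup[of A ?W] W.is_group is_group
    by (simp add: group_hom_def group_hom_axioms_def)
  let ?TT = "?W\<lparr>carrier := ?T\<rparr>"
  have i_hom: "i \<in> hom ?TT (A Mod P)"
  proof (rule homI)
    fix C D assume "C \<in> carrier ?TT" "D \<in> carrier ?TT"
    then obtain x y where xy: "x \<in> carrier A" "C = Q #> element_norm x" "y \<in> carrier A" "D = Q #> element_norm y"
      by auto
    have "C \<otimes>\<^bsub>?TT\<^esub> D = Q #> element_norm (x \<otimes> y)"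
      using xy hom_mult[OF norm_hom] by simp
    then have "i (C \<otimes>\<^bsub>?TT\<^esub> D) = P #> element_norm (x \<otimes> y)"
      using xy i_coset element_norm_fixed by simp
    then show "i (C \<otimes>\<^bsub>?TT\<^esub> D) = i C \<otimes>\<^bsub>A Mod P\<^esub> i D"
      using xy by (simp add: i_coset element_norm_fixed hom_mult[OF element_norm_hom] coset_mult)
  qed (auto simp: i_coset element_norm_fixed carrier_FactGroup)
  interpret i: group_hom ?TT "A Mod P" i
    using i_hom subgroup.subgroup_is_group[OF subT W.is_group] V.is_group
    by (simp add: group_hom_def group_hom_axioms_def)
  have i_image: "i ` ?T = V.norm ` carrier (A Mod P)"
  proof -
    have "i ` ?T = (\<lambda>x. P #> element_norm x) ` carrier A"
      unfolding image_image by (intro image_cong) (auto simp: i_coset element_norm_fixed)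
    also have "\<dots> = V.norm ` carrier (A Mod P)"
      unfolding carrier_FactGroup image_image by (intro image_cong) (auto simp: norm_coset)
    finally show ?thesis .
  qed
  \<comment> \<open>An infinite set has \<open>card\<close> 0, which is not a power of p.\<close>
  have "finite ?T" using T p1 card_eq_0_iff[of ?T] by auto
  then have "finite (V.norm ` carrier (A Mod P))" unfolding i_image[symmetric] by simp
  then have r: "p ^ r = card (V.norm ` carrier (A Mod P))"
    unfolding r_def by (rule V.power_max_free_rank)
  let ?K = "kernel ?TT (A Mod P) i"
  have card: "p ^ r * card ?K = p ^ t"
    using i.card_image_kernel T r i_image by simp
  then have "p ^ r dvd p ^ t" by (metis dvd_triv_left)
  then show "r \<le> t" using p1 by (rule power_dvd_imp_le)
  have U: "carrier U = (\<lambda>b. Q #> b) ` (fixed_points \<inter> P)"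
    unfolding U_def by (simp add: carrier_FactGroup)
  have KU: "?K \<subseteq> carrier U"
  proof
    fix C assume "C \<in> ?K"
    then obtain x where x: "x \<in> carrier A" "C = Q #> element_norm x" "i C = P"
      by (auto simp: kernel_def)
    then have "P #> element_norm x = P" by (simp add: i_coset element_norm_fixed)
    then have "element_norm x \<in> P" using x coset_join1 subgroup_P by simp
    then show "C \<in> carrier U" unfolding U using x element_norm_fixed by blast
  qed
  have subFP: "subgroup (fixed_points \<inter> P) A"
    by (rule subgroups_Inter_pair[OF subgroup_fixed_points subgroup_P])
  have BFP: "B\<lparr>carrier := fixed_points \<inter> P\<rparr> = A\<lparr>carrier := fixed_points \<inter> P\<rparr>" by simp
  interpret FP: comm_group "A\<lparr>carrier := fixed_points \<inter> P\<rparr>"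
    by (rule subgroup_imp_comm_group[OF subFP])
  have "subgroup Q A"
    using incl_subgroup[OF subgroup_fixed_points QB] .
  then have QFP: "subgroup Q (A\<lparr>carrier := fixed_points \<inter> P\<rparr>)"
    by (rule subgroup_incl[OF _ subFP Q_subset])
  \<comment> \<open>An element of \<open>fixed_points \<inter> P\<close> is in particular a fixed
    point, so its p-th power lies in \<open>Q\<close>; this gives \<open>U\<close> exponent
    p.\<close>
  have pow_FP: "powers p (A\<lparr>carrier := fixed_points \<inter> P\<rparr>) \<subseteq> Q"
    by (auto simp: powers_def pow_B nat_pow_consistent[symmetric])
  interpret U: elementary_abelian U p
    unfolding U_def BFP by (rule FP.elementary_abelian_quotient[OF prime_p QFP pow_FP])
  have finU: "finite (carrier U)" unfolding U by (rule finite_unit_kernel[OF fin])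
  have "p ^ t \<le> p ^ r * p ^ d_Fp p U"
    unfolding U.power_d_Fp[OF finU] card[symmetric] using card_mono[OF finU KU] by simp
  then have "p ^ t \<le> p ^ (r + d_Fp p U)" by (simp add: power_add)
  then show "t \<le> r + d_Fp p U" using p1 by (simp add: power_increasing_iff)
  show "t = r" if eq: "fixed_points \<inter> P = Q"
  proof -
    have "carrier U \<subseteq> {Q}"
      unfolding U eq using coset_join2[OF _ \<open>subgroup Q A\<close>] subgroup.mem_carrier[OF \<open>subgroup Q A\<close>] by auto
    then have "?K \<subseteq> {Q}" using KU by blast
    moreover have "?K \<noteq> {}" using subgroup.one_closed[OF i.subgroup_kernel] by blast
    ultimately have "?K = {Q}" by blast
    then have "p ^ r = p ^ t" using card by simp
    then show ?thesis using p1 by simp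
  qed
qed

end


section \<open>Units of rings of integers\<close>

lemma (in domain) finite_roots_of_unity:
  assumes "0 < n"
  shows "finite {x \<in> carrier R. x [^] (n::nat) = \<one>}"
proof -
  obtain m where n: "n = Suc m" using assms gr0_implies_Suc by blast
  \<comment> \<open>The polynomial X^n - 1, with its \<open>m\<close> = n - 1 vanishing middle
    coefficients.\<close>
  let ?q = "\<one> # replicate m \<zero> @ [\<ominus> \<one>]"
  have "?q \<in> carrier (poly_ring R)"
    by (auto simp: univ_poly_carrier[symmetric] polynomial_def)
  then have "finite {x. is_root ?q x}" by (rule finite_number_of_roots)
  moreover have "{x \<in> carrier R. x [^] n = \<one>} \<subseteq> {x. is_root ?q x}"
  proof safe
    fix x assume "x \<in> carrier R" "x [^] n = \<one>"
    then show "is_root ?q x"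
      using eval_replicate[of "[\<ominus> \<one>]" x m] by (simp add: is_root_def n r_neg del: nat_pow_Suc)
  qed
  ultimately show ?thesis by (rule rev_finite_subset)
qed

context domain
begin

lemma ring_of_integers_carrier:
  "x \<in> carrier (ring_of_integers R) \<longleftrightarrow> x \<in> carrier R \<and> integral x"
  by (auto simp: ring_of_integers_def integral_over_Z_iff)

lemma comm_monoid_ring_of_integers: "comm_monoid (ring_of_integers R)"
proof (rule comm_monoidI)
  fix x y assume "x \<in> carrier (ring_of_integers R)" "y \<in> carrier (ring_of_integers R)"
  then show "x \<otimes>\<^bsub>ring_of_integers R\<^esub> y \<in> carrier (ring_of_integers R)"
    unfolding ring_of_integers_carrier by (simp add: ring_of_integers_def integral_mult)
next
  show "\<one>\<^bsub>ring_of_integers R\<^esub> \<in> carrier (ring_of_integers R)"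
    unfolding ring_of_integers_carrier by (simp add: ring_of_integers_def integral_one)
qed (auto simp: ring_of_integers_def m_ac)

lemma comm_group_unit_group: "comm_group (unit_group R)"
  unfolding unit_group_def by (rule comm_monoid.units_comm_group[OF comm_monoid_ring_of_integers])

lemma unit_group_carrier:
  "x \<in> carrier (unit_group R) \<longleftrightarrow>
    x \<in> carrier R \<and> integral x \<and> (\<exists>y\<in>carrier R. integral y \<and> x \<otimes> y = \<one>)"
  unfolding unit_group_def units_of_def Units_def
  by (auto simp: ring_of_integers_carrier) (auto simp: ring_of_integers_def integral_over_Z_iff m_comm)

end

lemma mult_unit_group [simp]: "monoid.mult (unit_group R) = monoid.mult R"
  and one_unit_group [simp]: "\<one>\<^bsub>unit_group R\<^esub> = \<one>\<^bsub>R\<^esub>"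
  by (simp_all add: unit_group_def units_of_def ring_of_integers_def)

lemma (in domain) pow_unit_group: "x [^]\<^bsub>unit_group R\<^esub> (n::nat) = x [^] n"
  by (simp add: nat_pow_def)

text \<open>Needed because \<open>field_norm\<close> multiplies in F, whereas the norm of the
  abstract setting multiplies in the unit group.\<close>

lemma (in domain) finprod_unit_group:
  assumes "f \<in> I \<rightarrow> carrier (unit_group R)"
  shows "finprod R f I = finprod (unit_group R) f I"
proof -
  interpret U: comm_group "unit_group R" by (rule comm_group_unit_group)
  show ?thesis
    using assms
  proof (induction I rule: infinite_finite_induct)
    case (insert i I)
    then have "f \<in> I \<rightarrow> carrier R" "f i \<in> carrier R" by (auto simp: Pi_iff unit_group_carrier)
    then show ?case using insert by simp
  qed simp_all
qed


section \<open>Galois action on units\<close>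

lemma (in domain) group_galois_group:
  assumes "K \<subseteq> carrier R"
  shows "group (galois_group R K)"
proof -
  let ?S = "{\<sigma> \<in> Bij (carrier R). \<sigma> \<in> ring_hom R R \<and> (\<forall>x\<in>K. \<sigma> x = x)}"
  have "subgroup ?S (BijGroup (carrier R))"
  proof (rule group.subgroupI[OF group_BijGroup])
    show "?S \<subseteq> carrier (BijGroup (carrier R))" by (auto simp: BijGroup_def)
    have "(\<lambda>x\<in>carrier R. x) \<in> ?S"
      using assms by (auto simp: id_Bij intro!: ring_hom_memI)
    then show "?S \<noteq> {}" by blast
  next
    fix \<sigma> assume \<sigma>: "\<sigma> \<in> ?S"
    let ?\<tau> = "\<lambda>x\<in>carrier R. inv_into (carrier R) \<sigma> x"
    have bij: "bij_betw \<sigma> (carrier R) (carrier R)" using \<sigma> by (simp add: Bij_def)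
    have closed: "?\<tau> x \<in> carrier R" and inv: "\<sigma> (?\<tau> x) = x" if "x \<in> carrier R" for x
      using that bij bij_betw_inv_into_right[OF bij] bij_betwE[OF bij_betw_inv_into[OF bij]] by simp_all
    \<comment> \<open>To identify a value of the inverse it suffices to apply \<sigma>, so each
      homomorphism law for the inverse reduces to the one for \<sigma>.\<close>
    have eqI: "?\<tau> x = y" if "x \<in> carrier R" "y \<in> carrier R" "\<sigma> y = x" for x y
      using that bij_betw_inv_into_left[OF bij that(2)] by simp
    have hom: "\<sigma> \<in> ring_hom R R" using \<sigma> by simp
    have "?\<tau> \<in> ring_hom R R"
    proof (rule ring_hom_memI)
      fix x y assume xy: "x \<in> carrier R" "y \<in> carrier R"
      show "?\<tau> (x \<otimes> y) = ?\<tau> x \<otimes> ?\<tau> y"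
        by (rule eqI) (use xy closed inv ring_hom_mult[OF hom closed closed] in auto)
      show "?\<tau> (x \<oplus> y) = ?\<tau> x \<oplus> ?\<tau> y"
        by (rule eqI) (use xy closed inv ring_hom_add[OF hom closed closed] in auto)
    next
      show "?\<tau> \<one> = \<one>" by (rule eqI) (use ring_hom_one[OF hom] in auto)
    qed (rule closed)
    moreover have "?\<tau> \<in> Bij (carrier R)" using \<sigma> by (simp add: restrict_inv_into_Bij)
    moreover have "?\<tau> x = x" if "x \<in> K" for x
      by (rule eqI) (use \<sigma> that assms in auto)
    ultimately have "?\<tau> \<in> ?S" by blast
    then show "inv\<^bsub>BijGroup (carrier R)\<^esub> \<sigma> \<in> ?S" using \<sigma> by (simp add: inv_BijGroup)
  next
    fix \<sigma> \<tau> assume \<sigma>: "\<sigma> \<in> ?S" and \<tau>: "\<tau> \<in> ?S"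
    have hom: "\<sigma> \<in> ring_hom R R" "\<tau> \<in> ring_hom R R" using \<sigma> \<tau> by auto
    have "compose (carrier R) \<sigma> \<tau> \<in> ring_hom R R"
      by (rule ring_hom_memI)
        (simp_all add: compose_eq ring_hom_closed[OF hom(1)] ring_hom_closed[OF hom(2)]
          ring_hom_mult[OF hom(1)] ring_hom_mult[OF hom(2)] ring_hom_add[OF hom(1)] ring_hom_add[OF hom(2)]
          ring_hom_one[OF hom(1)] ring_hom_one[OF hom(2)])
    moreover have "compose (carrier R) \<sigma> \<tau> \<in> Bij (carrier R)" using \<sigma> \<tau> by (simp add: compose_Bij)
    moreover have "compose (carrier R) \<sigma> \<tau> x = x" if "x \<in> K" for x
      using \<sigma> \<tau> that assms by (auto simp: compose_eq)
    ultimately have "compose (carrier R) \<sigma> \<tau> \<in> ?S" by blast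
    then show "\<sigma> \<otimes>\<^bsub>BijGroup (carrier R)\<^esub> \<tau> \<in> ?S" using \<sigma> \<tau> by (simp add: BijGroup_def)
  qed
  then show ?thesis
    unfolding galois_group_def by (rule subgroup.subgroup_is_group) (rule group_BijGroup)
qed

lemma galois_group_mult:
  assumes "\<sigma> \<in> carrier (galois_group F K)" "\<tau> \<in> carrier (galois_group F K)" "x \<in> carrier F"
  shows "(\<sigma> \<otimes>\<^bsub>galois_group F K\<^esub> \<tau>) x = \<sigma> (\<tau> x)"
  using assms by (simp add: galois_group_def BijGroup_def compose_eq)

lemma galois_group_one: "x \<in> carrier F \<Longrightarrow> \<one>\<^bsub>galois_group F K\<^esub> x = x"
  by (simp add: galois_group_def BijGroup_def)

lemma galois_group_ring_hom: "\<sigma> \<in> carrier (galois_group F K) \<Longrightarrow> \<sigma> \<in> ring_hom F F"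
  by (simp add: galois_group_def)

lemma (in domain) galois_p_group_action:
  assumes "K \<subseteq> carrier R" "Factorial_Ring.prime p" "\<exists>n. Coset.order (galois_group R K) = p ^ n"
  shows "p_group_action (unit_group R) (galois_group R K) p (\<lambda>\<sigma>. \<sigma>)"
proof (intro p_group_action.intro p_group_action_axioms.intro comm_group_unit_group
    group_galois_group assms)
  fix \<sigma> assume "\<sigma> \<in> carrier (galois_group R K)"
  then have hom: "\<sigma> \<in> ring_hom R R" by (rule galois_group_ring_hom)
  show "\<sigma> \<in> hom (unit_group R) (unit_group R)"
  proof (rule homI)
    fix x assume "x \<in> carrier (unit_group R)"
    then obtain y where y: "x \<in> carrier R" "integral x" "y \<in> carrier R" "integral y" "x \<otimes> y = \<one>"
      by (auto simp: unit_group_carrier)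
    then have "\<sigma> x \<otimes> \<sigma> y = \<one>"
      using ring_hom_mult[OF hom, of x y] ring_hom_one[OF hom] by simp
    then show "\<sigma> x \<in> carrier (unit_group R)"
      unfolding unit_group_carrier using y integral_hom[OF hom] ring_hom_closed[OF hom] by blast
  qed (use ring_hom_mult[OF hom] in \<open>simp add: unit_group_carrier\<close>)
qed (simp_all add: galois_group_mult galois_group_one unit_group_carrier)

text \<open>By the Galois condition K consists of the fixed elements, and integrality is the same in
  K and in F. The point to check is that the inverse of a fixed unit is fixed as well.\<close>

lemma unit_group_fixed_field:
  assumes "finite_galois F K"
  shows "unit_group (F\<lparr>carrier := K\<rparr>) =
    (unit_group F)\<lparr>carrier := {x \<in> carrier (unit_group F). \<forall>\<sigma>\<in>carrier (galois_group F K). \<sigma> x = x}\<rparr>"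
proof -
  have F: "field F" and K: "subfield K F"
    and fixd: "{x \<in> carrier F. \<forall>\<sigma>\<in>carrier (galois_group F K). \<sigma> x = x} = K"
    using assms by (auto simp: finite_galois_def)
  interpret F: field F by (rule F)
  have ringK: "subring K F" using subfieldE(1)[OF K] .
  interpret K: domain "F\<lparr>carrier := K\<rparr>"
    by (rule F.subring_is_domain[OF ringK])
  have "carrier (unit_group (F\<lparr>carrier := K\<rparr>)) =
      {x \<in> carrier (unit_group F). \<forall>\<sigma>\<in>carrier (galois_group F K). \<sigma> x = x}" (is "?L = ?R")
  proof (intro equalityI subsetI)
    fix x assume "x \<in> ?L"
    then have "x \<in> K" "x \<in> carrier (unit_group F)"
      unfolding K.unit_group_carrier F.unit_group_carrier
      using subringE(1)[OF ringK] by (auto simp: F.integral_consistent[OF ringK])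
    then show "x \<in> ?R" using fixd by blast
  next
    fix x assume x: "x \<in> ?R"
    then obtain y where y: "x \<in> carrier F" "F.integral x" "y \<in> carrier F" "F.integral y" "x \<otimes>\<^bsub>F\<^esub> y = \<one>\<^bsub>F\<^esub>"
      by (auto simp: F.unit_group_carrier)
    have "x \<in> K" using x y fixd by blast
    \<comment> \<open>Applying \<sigma> to x y = 1 makes \<sigma> y another inverse of x.\<close>
    have "\<sigma> y = y" if \<sigma>: "\<sigma> \<in> carrier (galois_group F K)" for \<sigma>
    proof -
      have hom: "\<sigma> \<in> ring_hom F F" using \<sigma> by (rule galois_group_ring_hom)
      have "\<sigma> x = x" using x \<sigma> by blast
      then have "x \<otimes>\<^bsub>F\<^esub> \<sigma> y = \<one>\<^bsub>F\<^esub>"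
        using ring_hom_mult[OF hom y(1,3)] ring_hom_one[OF hom] y(5) by metis
      then show ?thesis
        using y ring_hom_closed[OF hom y(3)] by (metis F.m_comm F.inv_unique)
    qed
    then have "y \<in> K" using y fixd by blast
    then show "x \<in> ?L"
      unfolding K.unit_group_carrier using \<open>x \<in> K\<close> y by (auto simp: F.integral_consistent[OF ringK])
  qed
  then show ?thesis
    by (simp add: unit_group_def units_of_def ring_of_integers_def)
qed

text \<open>The product set in \<open>induced_norm\<close> is a single coset: the norm of y^p is the
  p-th power of a fixed point and is absorbed by \<open>Q\<close>.\<close>

lemma (in p_group_action) set_mult_element_norm_coset:
  assumes x: "x \<in> carrier A"
  shows "Q <#> element_norm ` (P #> x) = Q #> element_norm x"
proof (intro equalityI subsetI)
  have Qc: "q \<in> carrier A" if "q \<in> Q" for q using that Q_subset by (auto simp: fixed_points_def)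
  fix z assume "z \<in> Q <#> element_norm ` (P #> x)"
  then obtain q y where q: "q \<in> Q" and y: "y \<in> carrier A" and z: "z = q \<otimes> element_norm (y [^] p \<otimes> x)"
    by (auto simp: set_mult_def r_coset_def powers_def)
  interpret N: group_hom A A element_norm using element_norm_hom by unfold_locales
  have "z = q \<otimes> element_norm y [^] p \<otimes> element_norm x"
    using x y Qc[OF q] z by (simp add: N.hom_mult N.hom_nat_pow m_assoc)
  moreover have "element_norm y [^] p \<in> Q"
    using element_norm_fixed[OF y] by (auto simp: powers_def pow_B)
  then have "q \<otimes> element_norm y [^] p \<in> Q"
    using subgroup.m_closed[OF comm_group.subgroup_powers[OF comm_group_B] q] by simp
  ultimately show "z \<in> Q #> element_norm x" by (auto simp: r_coset_def)
next
  fix z assume "z \<in> Q #> element_norm x"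
  moreover have "x \<in> P #> x" by (rule rcos_self[OF x subgroup_P])
  ultimately show "z \<in> Q <#> element_norm ` (P #> x)"
    unfolding set_mult_def r_coset_def by blast
qed

text \<open>What remains is translation: every object of the statement is identified with its
  counterpart for the unit group under the Galois action, and the isomorphism with
  \<open>Fp_space p t\<close> is used through its cardinality.\<close>

theorem theorem2p3:
  fixes F :: "('a, 'b) ring_scheme" and K :: "'a set" and p t :: nat
  assumes "Factorial_Ring.prime p"
    and "number_field F"
    and "number_field (F\<lparr>carrier := K\<rparr>)"
    and "finite_galois F K"
    and "\<exists>n. Coset.order (galois_group F K) = p ^ n"
    and "(units_mod_powers p (F\<lparr>carrier := K\<rparr>))
           \<lparr>carrier := induced_norm p F K ` carrier (units_mod_powers p F)\<rparr> \<cong> Fp_space p t"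
  shows "t_G p F K \<le> t \<and> t \<le> t_G p F K + d_Fp p (unit_kernel p F K) \<and>
    (carrier (unit_group (F\<lparr>carrier := K\<rparr>)) \<inter> powers p (unit_group F) =
       powers p (unit_group (F\<lparr>carrier := K\<rparr>)) \<longrightarrow> t = t_G p F K)"
proof -
  have F: "field F" and K: "subfield K F" using assms(4) by (auto simp: finite_galois_def)
  interpret F: field F by (rule F)
  let ?A = "unit_group F" and ?G = "galois_group F K"
  have "K \<subseteq> carrier F" using subfieldE(3)[OF K] .
  then interpret p_group_action ?A ?G p "\<lambda>\<sigma>. \<sigma>"
    by (rule F.galois_p_group_action[OF _ assms(1,5)])
  have B: "unit_group (F\<lparr>carrier := K\<rparr>) = B"
    using unit_group_fixed_field[OF assms(4)] by (simp add: fixed_points_def)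
  have unit_carrier: "x \<in> carrier F" if "x \<in> carrier ?A" for x
    using that by (simp add: F.unit_group_carrier)
  have norm: "field_norm F K x = element_norm x" if "x \<in> carrier ?A" for x
    unfolding field_norm_def element_norm_def using that by (intro F.finprod_unit_group) auto
  have induced: "induced_norm p F K (P #>\<^bsub>?A\<^esub> x) = Q #>\<^bsub>?A\<^esub> element_norm x" if x: "x \<in> carrier ?A" for x
  proof -
    have "P #>\<^bsub>?A\<^esub> x \<subseteq> carrier ?A"
      using x subgroup.subset[OF subgroup_P] r_coset_subset_G by blast
    then have "field_norm F K ` (P #>\<^bsub>?A\<^esub> x) = element_norm ` (P #>\<^bsub>?A\<^esub> x)"
      by (intro image_cong) (auto simp: norm)
    then show ?thesis
      unfolding induced_norm_def Let_def B using set_mult_element_norm_coset[OF x] by simp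
  qed
  have "induced_norm p F K ` carrier (units_mod_powers p F) =
      (\<lambda>x. Q #>\<^bsub>?A\<^esub> element_norm x) ` carrier ?A"
    unfolding units_mod_powers_def carrier_FactGroup image_image by (intro image_cong refl induced)
  then have T: "card ((\<lambda>x. Q #>\<^bsub>?A\<^esub> element_norm x) ` carrier ?A) = p ^ t"
    using iso_same_card[OF assms(6)] card_Fp_space[of p t] prime_gt_0_nat[OF assms(1)] by simp
  have "{x \<in> carrier ?A. x [^]\<^bsub>?A\<^esub> p = \<one>\<^bsub>?A\<^esub>} \<subseteq> {x \<in> carrier F. x [^]\<^bsub>F\<^esub> p = \<one>\<^bsub>F\<^esub>}"
    using unit_carrier by (auto simp: F.pow_unit_group)
  then have fin: "finite {x \<in> carrier ?A. x [^]\<^bsub>?A\<^esub> p = \<one>\<^bsub>?A\<^esub>}"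
    using F.finite_roots_of_unity[OF prime_gt_0_nat[OF assms(1)]] by (rule finite_subset)
  have "units_module p F K = V.rep_module"
    unfolding units_module_def V.rep_module_def Let_def units_mod_powers_def ..
  then have t_G: "t_G p F K = max_free_rank (Fp_group_algebra p ?G) V.rep_module"
    by (simp add: t_G_def)
  have kernel: "unit_kernel p F K = B\<lparr>carrier := fixed_points \<inter> P\<rparr> Mod Q"
    unfolding unit_kernel_def Let_def B by simp
  have "carrier (unit_group (F\<lparr>carrier := K\<rparr>)) = fixed_points" unfolding B by simp
  then show ?thesis
    using norm_image_rank[OF fin T] unfolding t_G kernel B by simp
qed

end
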